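(* Let $R$ be a TAF-ring. Then for each maximal ideal $M$ of $R$, the localization $R_M$ is either a zero-dimensional ring or a one-dimensional domain. In particular, $\dim(R)\leq 1$.
   Context: All rings are commutative with identity; dimension means Krull dimension. An ideal $I$ of a ring $R$ is a 2-absorbing ideal (TA-ideal) if whenever $a,b,c\in R$ and $abc\in I$, then $ab\in I$ or $ac\in I$ or $bc\in I$. A TA-factorization of an ideal $I$ is an expression $I=J_1\cdots J_n$ as a product of proper TA-ideals. $R$ is a TAF-ring if every proper ideal of $R$ has a TA-factorization. *)

theory Defs
  imports
    "HOL-Algebra.Ideal_Product"
    "HOL-Library.Extended_Real"
begin

definition TA_ideal :: "('a, 'b) ring_scheme \<Rightarrow> 'a set \<Rightarrow> bool" where
  "TA_ideal R I \<longleftrightarrow> ideal I R \<and>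
     (\<forall>a\<in>carrier R. \<forall>b\<in>carrier R. \<forall>c\<in>carrier R.
        a \<otimes>\<^bsub>R\<^esub> b \<otimes>\<^bsub>R\<^esub> c \<in> I \<longrightarrow>
        a \<otimes>\<^bsub>R\<^esub> b \<in> I \<or> a \<otimes>\<^bsub>R\<^esub> c \<in> I \<or> b \<otimes>\<^bsub>R\<^esub> c \<in> I)"

text \<open>The base value \<open>carrier R\<close> is the unit ideal, the neutral element for products of ideals.\<close>

definition ideal_list_prod :: "('a, 'b) ring_scheme \<Rightarrow> 'a set list \<Rightarrow> 'a set" where
  "ideal_list_prod R Js = foldr (ideal_prod R) Js (carrier R)"

definition TA_factorization :: "('a, 'b) ring_scheme \<Rightarrow> 'a set \<Rightarrow> 'a set list \<Rightarrow> bool" where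
  "TA_factorization R I Js \<longleftrightarrow> Js \<noteq> [] \<and>
     (\<forall>J\<in>set Js. TA_ideal R J \<and> J \<noteq> carrier R) \<and> I = ideal_list_prod R Js"

definition TAF_ring :: "('a, 'b) ring_scheme \<Rightarrow> bool" where
  "TAF_ring R \<longleftrightarrow> cring R \<and>
     (\<forall>I. ideal I R \<and> I \<noteq> carrier R \<longrightarrow> (\<exists>Js. TA_factorization R I Js))"

lemma (in ring) ideal_list_prod_single:
  assumes "ideal J R"
  shows "ideal_list_prod R [J] = J"
  using ideal_prod_one[OF assms] by (simp add: ideal_list_prod_def)

text \<open>A chain \<open>P 0 \<subset> P 1 \<subset> \<dots> \<subset> P n\<close> of prime ideals has length \<open>n\<close>.
  The values are extended reals so that the supremum of the empty set is
  \<open>- \<infinity>\<close>, the dimension of the zero ring.\<close>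

definition prime_chain :: "('a, 'b) ring_scheme \<Rightarrow> nat \<Rightarrow> (nat \<Rightarrow> 'a set) \<Rightarrow> bool" where
  "prime_chain R n P \<longleftrightarrow> (\<forall>i\<le>n. primeideal (P i) R) \<and> (\<forall>i<n. P i \<subset> P (Suc i))"

definition krull_dim :: "('a, 'b) ring_scheme \<Rightarrow> ereal" where
  "krull_dim R = (SUP n\<in>{n. \<exists>P. prime_chain R n P}. ereal (real n))"

text \<open>Fractions \<open>a/s\<close> are the classes of pairs \<open>(a, s)\<close>; since \<open>R\<close> may have
  zero divisors, \<open>a/s = b/t\<close> means \<open>u t a = u s b\<close> for some \<open>u\<close> in \<open>S\<close>.
  \<open>S\<close> is supposed to be a multiplicative submonoid.\<close>

definition frac_rel :: "('a, 'b) ring_scheme \<Rightarrow> 'a set \<Rightarrow> (('a \<times> 'a) \<times> ('a \<times> 'a)) set" where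
  "frac_rel R S = {((a, s), (b, t)). a \<in> carrier R \<and> s \<in> S \<and> b \<in> carrier R \<and> t \<in> S \<and>
     (\<exists>u\<in>S. u \<otimes>\<^bsub>R\<^esub> (t \<otimes>\<^bsub>R\<^esub> a) = u \<otimes>\<^bsub>R\<^esub> (s \<otimes>\<^bsub>R\<^esub> b))}"

definition fraction :: "('a, 'b) ring_scheme \<Rightarrow> 'a set \<Rightarrow> 'a \<Rightarrow> 'a \<Rightarrow> ('a \<times> 'a) set" where
  "fraction R S a s = frac_rel R S `` {(a, s)}"

definition localization :: "('a, 'b) ring_scheme \<Rightarrow> 'a set \<Rightarrow> ('a \<times> 'a) set ring" where
  "localization R S = \<lparr>
     carrier = (carrier R \<times> S) // frac_rel R S,
     monoid.mult = (\<lambda>A B. \<Union>(a, s)\<in>A. \<Union>(b, t)\<in>B. fraction R S (a \<otimes>\<^bsub>R\<^esub> b) (s \<otimes>\<^bsub>R\<^esub> t)),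
     one = fraction R S \<one>\<^bsub>R\<^esub> \<one>\<^bsub>R\<^esub>,
     zero = fraction R S \<zero>\<^bsub>R\<^esub> \<one>\<^bsub>R\<^esub>,
     add = (\<lambda>A B. \<Union>(a, s)\<in>A. \<Union>(b, t)\<in>B.
              fraction R S (t \<otimes>\<^bsub>R\<^esub> a \<oplus>\<^bsub>R\<^esub> s \<otimes>\<^bsub>R\<^esub> b) (s \<otimes>\<^bsub>R\<^esub> t)) \<rparr>"

definition localization_at :: "('a, 'b) ring_scheme \<Rightarrow> 'a set \<Rightarrow> ('a \<times> 'a) set ring" where
  "localization_at R P = localization R (carrier R - P)"

context cring
begin

context
  fixes S
  assumes S: "submonoid S R"
begin

lemma S_carr: "s \<in> S \<Longrightarrow> s \<in> carrier R"
  using submonoid.subset[OF S] by auto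

lemma S_mult: "s \<in> S \<Longrightarrow> t \<in> S \<Longrightarrow> s \<otimes> t \<in> S"
  using submonoid.m_closed[OF S] by auto

lemma S_one: "\<one> \<in> S"
  using submonoid.one_closed[OF S] by auto

lemma frac_relI:
  assumes "a \<in> carrier R" "s \<in> S" "b \<in> carrier R" "t \<in> S" "u \<in> S"
    "u \<otimes> (t \<otimes> a) = u \<otimes> (s \<otimes> b)"
  shows "((a, s), (b, t)) \<in> frac_rel R S"
  using assms by (auto simp: frac_rel_def)

lemma equiv_frac_rel: "equiv (carrier R \<times> S) (frac_rel R S)"
proof (rule equivI)
  show "frac_rel R S \<subseteq> (carrier R \<times> S) \<times> (carrier R \<times> S)"
    by (auto simp: frac_rel_def)
  show "refl_on (carrier R \<times> S) (frac_rel R S)"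
    using S_one by (auto simp: refl_on_def frac_rel_def)
  show "sym (frac_rel R S)"
    by (auto simp: sym_def frac_rel_def) metis
  show "trans (frac_rel R S)"
  proof (rule transI, clarify)
    fix a s b t c w
    assume "((a, s), (b, t)) \<in> frac_rel R S" "((b, t), (c, w)) \<in> frac_rel R S"
    then obtain u v where m: "a \<in> carrier R" "s \<in> S" "b \<in> carrier R" "t \<in> S"
        "c \<in> carrier R" "w \<in> S" "u \<in> S" "v \<in> S"
      and e1: "u \<otimes> (t \<otimes> a) = u \<otimes> (s \<otimes> b)" and e2: "v \<otimes> (w \<otimes> b) = v \<otimes> (t \<otimes> c)"
      by (auto simp: frac_rel_def)
    note c = m S_carr[OF m(2)] S_carr[OF m(4)] S_carr[OF m(6)] S_carr[OF m(7)] S_carr[OF m(8)]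
    have "(u \<otimes> v \<otimes> t) \<otimes> (w \<otimes> a) = (v \<otimes> w) \<otimes> (u \<otimes> (t \<otimes> a))"
      using c by (simp add: m_ac)
    also have "\<dots> = (u \<otimes> s) \<otimes> (v \<otimes> (w \<otimes> b))"
      unfolding e1 using c by (simp add: m_ac)
    also have "\<dots> = (u \<otimes> v \<otimes> t) \<otimes> (s \<otimes> c)"
      unfolding e2 using c by (simp add: m_ac)
    finally show "((a, s), (c, w)) \<in> frac_rel R S"
      using m by (intro frac_relI[where u = "u \<otimes> v \<otimes> t"] S_mult)
  qed
qed

lemma fraction_eq_iff:
  assumes "a \<in> carrier R" "s \<in> S" "b \<in> carrier R" "t \<in> S"
  shows "fraction R S a s = fraction R S b t \<longleftrightarrow> (\<exists>u\<in>S. u \<otimes> (t \<otimes> a) = u \<otimes> (s \<otimes> b))"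
  unfolding fraction_def using assms eq_equiv_class_iff[OF equiv_frac_rel, of "(a, s)" "(b, t)"]
  by (auto simp: frac_rel_def)

lemma carrier_localization:
  "carrier (localization R S) = {fraction R S a s | a s. a \<in> carrier R \<and> s \<in> S}"
  by (auto simp: localization_def fraction_def quotient_def)

lemma mult_fraction_cong:
  assumes r: "((a, s), (b, t)) \<in> frac_rel R S" and c: "c \<in> carrier R" "v \<in> S"
  shows "fraction R S (c \<otimes> a) (v \<otimes> s) = fraction R S (c \<otimes> b) (v \<otimes> t)"
proof -
  from r obtain u where m: "a \<in> carrier R" "s \<in> S" "b \<in> carrier R" "t \<in> S" "u \<in> S"
    and e: "u \<otimes> (t \<otimes> a) = u \<otimes> (s \<otimes> b)" by (auto simp: frac_rel_def)
  note n = m c S_carr[OF m(2)] S_carr[OF m(4)] S_carr[OF m(5)] S_carr[OF c(2)]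
  have "u \<otimes> ((v \<otimes> t) \<otimes> (c \<otimes> a)) = (v \<otimes> c) \<otimes> (u \<otimes> (t \<otimes> a))"
    using n by (simp add: m_ac)
  also have "\<dots> = u \<otimes> ((v \<otimes> s) \<otimes> (c \<otimes> b))"
    unfolding e using n by (simp add: m_ac)
  finally show ?thesis
    using n by (subst fraction_eq_iff) (auto intro: S_mult)
qed

lemma add_fraction_cong:
  assumes r: "((a, s), (b, t)) \<in> frac_rel R S" and c: "c \<in> carrier R" "v \<in> S"
  shows "fraction R S (s \<otimes> c \<oplus> v \<otimes> a) (v \<otimes> s) = fraction R S (t \<otimes> c \<oplus> v \<otimes> b) (v \<otimes> t)"
proof -
  from r obtain u where m: "a \<in> carrier R" "s \<in> S" "b \<in> carrier R" "t \<in> S" "u \<in> S"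
    and e: "u \<otimes> (t \<otimes> a) = u \<otimes> (s \<otimes> b)" by (auto simp: frac_rel_def)
  note n = m c S_carr[OF m(2)] S_carr[OF m(4)] S_carr[OF m(5)] S_carr[OF c(2)]
  have "u \<otimes> ((v \<otimes> t) \<otimes> (s \<otimes> c \<oplus> v \<otimes> a))
      = u \<otimes> (v \<otimes> (t \<otimes> (s \<otimes> c))) \<oplus> (v \<otimes> v) \<otimes> (u \<otimes> (t \<otimes> a))"
    using n by (simp add: m_ac r_distr)
  also have "\<dots> = u \<otimes> ((v \<otimes> s) \<otimes> (t \<otimes> c \<oplus> v \<otimes> b))"
    unfolding e using n by (simp add: m_ac r_distr)
  finally show ?thesis
    using n by (subst fraction_eq_iff) (auto intro: S_mult)
qed

lemma localization_mult:
  assumes m: "a \<in> carrier R" "s \<in> S" "b \<in> carrier R" "t \<in> S"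
  shows "fraction R S a s \<otimes>\<^bsub>localization R S\<^esub> fraction R S b t = fraction R S (a \<otimes> b) (s \<otimes> t)"
proof -
  let ?f = "\<lambda>p q. fraction R S (fst p \<otimes> fst q) (snd p \<otimes> snd q)"
  have "?f respects2 frac_rel R S"
  proof (rule congruent2_commuteI[OF equiv_frac_rel])
    show "?f y z = ?f z y" if "y \<in> carrier R \<times> S" "z \<in> carrier R \<times> S" for y z
      using that by (auto simp: m_comm S_carr)
    show "?f w y = ?f w z" if "w \<in> carrier R \<times> S" "(y, z) \<in> frac_rel R S" for w y z
      using that mult_fraction_cong[of "fst y" "snd y" "fst z" "snd z" "fst w" "snd w"] by auto
  qed
  from UN_equiv_class2[OF equiv_frac_rel equiv_frac_rel this, of "(a, s)" "(b, t)"] m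
  show ?thesis
    by (simp add: localization_def fraction_def case_prod_unfold)
qed

lemma localization_add:
  assumes m: "a \<in> carrier R" "s \<in> S" "b \<in> carrier R" "t \<in> S"
  shows "fraction R S a s \<oplus>\<^bsub>localization R S\<^esub> fraction R S b t
       = fraction R S (t \<otimes> a \<oplus> s \<otimes> b) (s \<otimes> t)"
proof -
  let ?f = "\<lambda>p q. fraction R S (snd q \<otimes> fst p \<oplus> snd p \<otimes> fst q) (snd p \<otimes> snd q)"
  have "?f respects2 frac_rel R S"
  proof (rule congruent2_commuteI[OF equiv_frac_rel])
    show "?f y z = ?f z y" if "y \<in> carrier R \<times> S" "z \<in> carrier R \<times> S" for y z
      using that by (auto simp: m_comm a_comm S_carr)
    show "?f w y = ?f w z" if "w \<in> carrier R \<times> S" "(y, z) \<in> frac_rel R S" for w y z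
      using that add_fraction_cong[of "fst y" "snd y" "fst z" "snd z" "fst w" "snd w"] by auto
  qed
  from UN_equiv_class2[OF equiv_frac_rel equiv_frac_rel this, of "(a, s)" "(b, t)"] m
  show ?thesis
    by (simp add: localization_def fraction_def case_prod_unfold)
qed

lemma localization_one: "\<one>\<^bsub>localization R S\<^esub> = fraction R S \<one> \<one>"
  and localization_zero: "\<zero>\<^bsub>localization R S\<^esub> = fraction R S \<zero> \<one>"
  by (simp_all add: localization_def)

lemma cring_localization: "cring (localization R S)"
proof -
  let ?L = "localization R S"
  have elim: thesis if "x \<in> carrier ?L"
    and "\<And>a s. a \<in> carrier R \<Longrightarrow> s \<in> S \<Longrightarrow> s \<in> carrier R \<Longrightarrow> x = fraction R S a s \<Longrightarrow> thesis"
    for x thesis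
    using that S_carr by (auto simp: carrier_localization)
  have mem: "fraction R S a s \<in> carrier ?L" if "a \<in> carrier R" "s \<in> S" for a s
    using that by (auto simp: carrier_localization)
  note simps = localization_mult localization_add localization_one localization_zero
    mem S_one S_mult
  show ?thesis
  proof (rule cringI)
    show "abelian_group ?L"
    proof (rule abelian_groupI)
      fix x y z assume "x \<in> carrier ?L" "y \<in> carrier ?L" "z \<in> carrier ?L"
      then show "x \<oplus>\<^bsub>?L\<^esub> y \<oplus>\<^bsub>?L\<^esub> z = x \<oplus>\<^bsub>?L\<^esub> (y \<oplus>\<^bsub>?L\<^esub> z)"
        by (elim elim) (simp add: simps r_distr m_ac a_ac)
    next
      fix x assume "x \<in> carrier ?L"
      then obtain a s where m: "a \<in> carrier R" "s \<in> S" "s \<in> carrier R" "x = fraction R S a s"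
        by (elim elim)
      then have "fraction R S (\<ominus> a) s \<oplus>\<^bsub>?L\<^esub> x = fraction R S \<zero> (s \<otimes> s)"
        by (simp add: simps r_minus l_neg)
      also have "\<dots> = \<zero>\<^bsub>?L\<^esub>"
        unfolding localization_zero using m
        by (subst fraction_eq_iff) (auto simp: S_one S_mult)
      finally show "\<exists>y\<in>carrier ?L. y \<oplus>\<^bsub>?L\<^esub> x = \<zero>\<^bsub>?L\<^esub>"
        using m mem by blast
    qed (elim elim, simp add: simps a_comm m_comm; fail | simp add: simps; fail)+
  next
    show "Group.comm_monoid ?L"
      by (rule comm_monoidI; (elim elim)?; simp add: simps m_ac)
  next
    fix x y z assume "x \<in> carrier ?L" "y \<in> carrier ?L" "z \<in> carrier ?L"
    then show "(x \<oplus>\<^bsub>?L\<^esub> y) \<otimes>\<^bsub>?L\<^esub> z = x \<otimes>\<^bsub>?L\<^esub> z \<oplus>\<^bsub>?L\<^esub> y \<otimes>\<^bsub>?L\<^esub> z"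
    proof (elim elim)
      fix a s b t c v
      assume m: "a \<in> carrier R" "s \<in> S" "s \<in> carrier R" "x = fraction R S a s"
        "b \<in> carrier R" "t \<in> S" "t \<in> carrier R" "y = fraction R S b t"
        "c \<in> carrier R" "v \<in> S" "v \<in> carrier R" "z = fraction R S c v"
      have "fraction R S ((t \<otimes> a \<oplus> s \<otimes> b) \<otimes> c) (s \<otimes> t \<otimes> v)
          = fraction R S (t \<otimes> v \<otimes> (a \<otimes> c) \<oplus> s \<otimes> v \<otimes> (b \<otimes> c)) (s \<otimes> v \<otimes> (t \<otimes> v))"
        using m by (subst fraction_eq_iff) (auto simp: S_mult S_one l_distr r_distr m_ac)
      then show ?thesis
        using m by (simp add: simps)
    qed
  qed
qed

end

lemma submonoid_compl_prime:
  assumes "primeideal P R"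
  shows "submonoid (carrier R - P) R"
proof -
  interpret P: primeideal P R by (rule assms)
  show ?thesis
    using P.I_prime P.one_imp_carrier P.I_notcarr by unfold_locales auto
qed

lemma cring_localization_at: "primeideal P R \<Longrightarrow> cring (localization_at R P)"
  unfolding localization_at_def
  by (intro cring_localization submonoid_compl_prime)

end

end

theory Submission
  imports Defs
begin

text \<open>
  A TA-ideal \<open>J\<close> contains the square of its radical and has at most two minimal primes; hence
  in a TAF-ring every proper ideal has only finitely many minimal primes. If \<open>Q\<close> is a minimal
  prime of an ideal \<open>K\<close> that has \<open>l\<close> factors inside \<open>Q\<close>, then \<open>K \<subseteq> Q\<^sup>l\<close>, and
  \<open>Q\<^sup>2\<^sup>l \<subseteq> K\<close> after localization at \<open>Q\<close>. Applied to \<open>K = P + (x\<^sup>2\<^sup>k)\<close> this shows that a prime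
  \<open>P \<subset> Q\<close> with \<open>Q\<close> minimal over \<open>P + (x)\<close> lies in every power of \<open>Q\<close>.

  The main step: if \<open>Q\<close> is minimal over \<open>I + (y, x)\<close> and \<open>I + (y) \<subseteq> P \<subset> Q\<close> with \<open>P\<close> prime, then
  \<open>y \<in> I\<close> locally at \<open>Q\<close>. Indeed \<open>P \<subseteq> I + (y\<^sup>2, x\<^sup>2)\<close> locally, so \<open>P \<subseteq> I + (x\<^sup>2)\<close>. Some factor
  \<open>J\<close> of \<open>I + (y)\<close> lies in \<open>P\<close>, and \<open>x\<^sup>2 t \<in> J\<close> forces \<open>x t \<in> J\<close> since \<open>x\<^sup>2 \<notin> J\<close>; thus
  \<open>J \<subseteq> x J + I\<close>, whence \<open>y \<in> x (y) + I\<close> and \<open>y \<in> I\<close>.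

  Given primes \<open>P \<subset> M\<close> and \<open>y \<in> P\<close>, prime avoidance provides \<open>x \<in> M\<close> outside all minimal primes
  of \<open>I + (y)\<close>. Taking \<open>I\<close> prime excludes chains of three primes; taking \<open>I = 0\<close> then shows
  that \<open>P\<close> vanishes in \<open>R\<^sub>M\<close>.
\<close>

text \<open>Minimality of \<open>Q\<close> over \<open>I\<close> in the form \<open>Q R\<^sub>Q = \<surd>(I R\<^sub>Q)\<close>.\<close>

definition min_prime_over :: "('a, 'b) ring_scheme \<Rightarrow> 'a set \<Rightarrow> 'a set \<Rightarrow> bool" where
  "min_prime_over R Q I \<longleftrightarrow> primeideal Q R \<and> I \<subseteq> Q \<and>
     (\<forall>a\<in>Q. \<exists>n::nat. \<exists>s\<in>carrier R - Q. s \<otimes>\<^bsub>R\<^esub> a [^]\<^bsub>R\<^esub> n \<in> I)"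

text \<open>The preimage in \<open>R\<close> of the extension of \<open>I\<close> to the
  localization at \<open>T\<close>. Membership in it expresses "locally" without leaving
  \<open>R\<close>.\<close>

definition saturation :: "('a, 'b) ring_scheme \<Rightarrow> 'a set \<Rightarrow> 'a set \<Rightarrow> 'a set" where
  "saturation R T I = {a \<in> carrier R. \<exists>s\<in>T. s \<otimes>\<^bsub>R\<^esub> a \<in> I}"

definition adjoin :: "('a, 'b) ring_scheme \<Rightarrow> 'a set \<Rightarrow> 'a \<Rightarrow> 'a set" where
  "adjoin R I x = {i \<oplus>\<^bsub>R\<^esub> r \<otimes>\<^bsub>R\<^esub> x | i r. i \<in> I \<and> r \<in> carrier R}"

text \<open>This is \<open>x K + I\<close>. Keeping the ideal \<open>K\<close> as a parameter lets
  the relation \<open>K \<subseteq> x K + I\<close>, valid up to saturation, pass from one factor of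
  a product to the whole product.\<close>

definition scaled_sum :: "('a, 'b) ring_scheme \<Rightarrow> 'a \<Rightarrow> 'a set \<Rightarrow> 'a set \<Rightarrow> 'a set" where
  "scaled_sum R x K I = {x \<otimes>\<^bsub>R\<^esub> k \<oplus>\<^bsub>R\<^esub> i | k i. k \<in> K \<and> i \<in> I}"

primrec ideal_power :: "('a, 'b) ring_scheme \<Rightarrow> 'a set \<Rightarrow> nat \<Rightarrow> 'a set" where
  "ideal_power R I 0 = carrier R"
| "ideal_power R I (Suc n) = ideal_prod R I (ideal_power R I n)"

section \<open>Ideals of a commutative ring\<close>

lemma (in ideal) l_cancel_closed:
  assumes "a \<oplus> b \<in> I" "b \<in> I" "a \<in> carrier R"
  shows "a \<in> I"
proof -
  have "(a \<oplus> b) \<oplus> \<ominus> b \<in> I"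
    using assms additive_subgroup.a_closed[OF additive_subgroup_axioms]
      additive_subgroup.a_inv_closed[OF additive_subgroup_axioms] by blast
  moreover have "(a \<oplus> b) \<oplus> \<ominus> b = a"
    using assms(3) Icarr[OF assms(2)] by (simp add: a_assoc r_neg)
  ultimately show ?thesis by simp
qed

lemma (in primeideal) pow_mem_iff:
  assumes "a \<in> carrier R"
  shows "a [^] (n::nat) \<in> I \<longleftrightarrow> n \<noteq> 0 \<and> a \<in> I"
proof (induction n)
  case 0
  then show ?case using one_imp_carrier I_notcarr by auto
next
  case (Suc n)
  then show ?case
    using assms I_prime[of "a [^] n" a] I_l_closed[of a "a [^] n"] by auto
qed

context cring
begin

lemma idealI_cring:
  assumes "I \<subseteq> carrier R" "\<zero> \<in> I" "\<And>a b. a \<in> I \<Longrightarrow> b \<in> I \<Longrightarrow> a \<oplus> b \<in> I"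
    "\<And>a r. a \<in> I \<Longrightarrow> r \<in> carrier R \<Longrightarrow> r \<otimes> a \<in> I"
  shows "ideal I R"
proof (rule idealI[OF ring_axioms])
  have "\<ominus> a \<in> I" if "a \<in> I" for a
    using assms(4)[OF that, of "\<ominus> \<one>"] that assms(1) by (auto simp: l_minus)
  then show "subgroup I (add_monoid R)"
    using assms by (intro add.subgroupI) (auto simp: a_inv_def)
qed (use assms in \<open>auto simp: m_comm subset_iff\<close>)

lemma ideal_mult_carrier:
  "ideal I R \<Longrightarrow> a \<in> I \<Longrightarrow> r \<in> carrier R \<Longrightarrow> r \<otimes> a \<in> I"
  by (simp add: ideal.I_l_closed)

lemma ideal_add_mem: "ideal I R \<Longrightarrow> a \<in> I \<Longrightarrow> b \<in> I \<Longrightarrow> a \<oplus> b \<in> I"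
  by (simp add: additive_subgroup.a_closed ideal.axioms(1))

lemma ideal_zero_mem: "ideal I R \<Longrightarrow> \<zero> \<in> I"
  by (simp add: additive_subgroup.zero_closed ideal.axioms(1))

lemma ideal_subset_carrier: "ideal I R \<Longrightarrow> I \<subseteq> carrier R"
  by (auto simp: ideal.Icarr)

section \<open>Saturation at a submonoid\<close>

lemma saturation_ideal:
  assumes T: "submonoid T R" and I: "ideal I R"
  shows "ideal (saturation R T I) R"
proof (rule idealI_cring)
  interpret T: submonoid T R by (rule T)
  show "\<zero> \<in> saturation R T I"
  proof -
    have "\<one> \<otimes> \<zero> \<in> I" using ideal_zero_mem[OF I] by simp
    then show ?thesis using T.one_closed unfolding saturation_def by blast
  qed
  show "a \<oplus> b \<in> saturation R T I" if "a \<in> saturation R T I" "b \<in> saturation R T I" for a b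
  proof -
    from that obtain s t where st: "s \<in> T" "t \<in> T" "s \<otimes> a \<in> I" "t \<otimes> b \<in> I"
      and c: "a \<in> carrier R" "b \<in> carrier R"
      by (auto simp: saturation_def)
    note c = c T.subset[THEN subsetD, OF st(1)] T.subset[THEN subsetD, OF st(2)]
    have "t \<otimes> (s \<otimes> a) \<oplus> s \<otimes> (t \<otimes> b) \<in> I"
      by (rule ideal_add_mem[OF I ideal_mult_carrier[OF I st(3)] ideal_mult_carrier[OF I st(4)]])
        (use c in simp_all)
    moreover have "t \<otimes> (s \<otimes> a) \<oplus> s \<otimes> (t \<otimes> b) = (s \<otimes> t) \<otimes> (a \<oplus> b)"
      using c by (simp add: r_distr m_ac)
    ultimately show ?thesis using st c T.m_closed by (auto simp: saturation_def)
  qed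
  show "r \<otimes> a \<in> saturation R T I" if "a \<in> saturation R T I" "r \<in> carrier R" for a r
  proof -
    from that obtain s where s: "s \<in> T" "s \<otimes> a \<in> I" and c: "a \<in> carrier R"
      by (auto simp: saturation_def)
    have "s \<otimes> (r \<otimes> a) = r \<otimes> (s \<otimes> a)"
      using c that T.subset s by (simp add: m_ac subset_iff)
    then have "s \<otimes> (r \<otimes> a) \<in> I" using that ideal_mult_carrier[OF I s(2)] by simp
    then show ?thesis using s(1) c that(2) unfolding saturation_def by blast
  qed
qed (auto simp: saturation_def)

lemma subset_saturation:
  assumes T: "submonoid T R" and I: "ideal I R"
  shows "I \<subseteq> saturation R T I"
proof
  fix a assume "a \<in> I"
  moreover from this have "\<one> \<otimes> a \<in> I" using ideal.Icarr[OF I] by simp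
  ultimately show "a \<in> saturation R T I"
    using submonoid.one_closed[OF T] ideal.Icarr[OF I] unfolding saturation_def by blast
qed

lemma saturation_mem_cancel:
  assumes T: "submonoid T R" and "a \<in> carrier R" "s \<in> T" "s \<otimes> a \<in> saturation R T I"
  shows "a \<in> saturation R T I"
proof -
  interpret T: submonoid T R by (rule T)
  from assms obtain t where t: "t \<in> T" "t \<otimes> (s \<otimes> a) \<in> I" by (auto simp: saturation_def)
  then have "t \<otimes> s \<otimes> a \<in> I"
    using assms T.subset by (simp add: m_assoc subset_iff)
  then show ?thesis using t assms T.m_closed by (auto simp: saturation_def)
qed

text \<open>Local inclusions compose, because the product of two denominators is again in
  \<open>T\<close>.\<close>

lemma saturation_saturation:
  assumes T: "submonoid T R" and "K \<subseteq> saturation R T I"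
  shows "saturation R T K \<subseteq> saturation R T I"
  using assms saturation_mem_cancel[OF T, of _ _ I] by (auto simp: saturation_def[of R T K])

section \<open>Adjoining one element to an ideal\<close>

lemma adjoin_ideal:
  assumes I: "ideal I R" and x: "x \<in> carrier R"
  shows "ideal (adjoin R I x) R"
proof (rule idealI_cring)
  note c = ideal.Icarr[OF I] x
  show "adjoin R I x \<subseteq> carrier R" using c by (auto simp: adjoin_def)
  have "\<zero> = \<zero> \<oplus> \<zero> \<otimes> x" using x by simp
  then show "\<zero> \<in> adjoin R I x" using ideal_zero_mem[OF I] by (force simp: adjoin_def)
  show "a \<oplus> b \<in> adjoin R I x" if a: "a \<in> adjoin R I x" and b: "b \<in> adjoin R I x" for a b
  proof -
    from a b obtain i r j q where e: "a = i \<oplus> r \<otimes> x" "b = j \<oplus> q \<otimes> x"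
      "i \<in> I" "j \<in> I" "r \<in> carrier R" "q \<in> carrier R" by (auto simp: adjoin_def)
    have "a \<oplus> b = (i \<oplus> j) \<oplus> (r \<oplus> q) \<otimes> x"
      using e c by (simp add: l_distr a_ac)
    then show ?thesis
      using e ideal_add_mem[OF I] unfolding adjoin_def by blast
  qed
  show "q \<otimes> a \<in> adjoin R I x" if a: "a \<in> adjoin R I x" and q: "q \<in> carrier R" for a q
  proof -
    from a obtain i r where e: "a = i \<oplus> r \<otimes> x" "i \<in> I" "r \<in> carrier R" by (auto simp: adjoin_def)
    have "q \<otimes> a = q \<otimes> i \<oplus> (q \<otimes> r) \<otimes> x"
      using e c q by (simp add: r_distr m_assoc)
    then show ?thesis
      using e q ideal_mult_carrier[OF I] unfolding adjoin_def by blast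
  qed
qed

lemma subset_adjoin: "I \<subseteq> carrier R \<Longrightarrow> x \<in> carrier R \<Longrightarrow> I \<subseteq> adjoin R I x"
proof
  fix i assume "I \<subseteq> carrier R" "x \<in> carrier R" "i \<in> I"
  moreover from this have "i = i \<oplus> \<zero> \<otimes> x" by auto
  ultimately show "i \<in> adjoin R I x" unfolding adjoin_def by blast
qed

lemma mem_adjoin:
  assumes "ideal I R" "x \<in> carrier R"
  shows "x \<in> adjoin R I x"
proof -
  have "x = \<zero> \<oplus> \<one> \<otimes> x" using assms by simp
  then show ?thesis using ideal_zero_mem[OF assms(1)] unfolding adjoin_def by blast
qed

lemma adjoin_subset: "ideal J R \<Longrightarrow> I \<subseteq> J \<Longrightarrow> x \<in> J \<Longrightarrow> adjoin R I x \<subseteq> J"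
  by (auto simp: adjoin_def intro!: ideal_add_mem ideal_mult_carrier)

section \<open>Radicals and minimal primes\<close>

text \<open>The coefficient \<open>c\<close> replaces the binomial formula: one factor
  \<open>a\<close> or \<open>b\<close> is moved into it, which lowers \<open>n + m\<close>, and the
  two results for \<open>c a\<close> and \<open>c b\<close> are added.\<close>

lemma radical_add:
  assumes I: "ideal I R" and a: "a \<in> carrier R" and b: "b \<in> carrier R"
  shows "c \<in> carrier R \<Longrightarrow> c \<otimes> a [^] (n::nat) \<in> I \<Longrightarrow> c \<otimes> b [^] (m::nat) \<in> I
    \<Longrightarrow> \<exists>k::nat. c \<otimes> (a \<oplus> b) [^] k \<in> I"
proof (induction "n + m" arbitrary: n m c rule: less_induct)
  case less
  show ?case
  proof (cases "n = 0 \<or> m = 0")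
    case True
    then have "c \<otimes> (a \<oplus> b) [^] (0::nat) \<in> I" using less.prems by auto
    then show ?thesis by blast
  next
    case False
    then obtain n' m' where nm: "n = Suc n'" "m = Suc m'" by (meson not0_implies_Suc)
    note c = a b less.prems(1)
    have ac: "\<exists>k::nat. (c \<otimes> a) \<otimes> (a \<oplus> b) [^] k \<in> I"
    proof (rule less.hyps[of n' m])
      have "c \<otimes> a [^] n = c \<otimes> a \<otimes> a [^] n'" using c by (simp add: nm m_ac)
      then show "c \<otimes> a \<otimes> a [^] n' \<in> I" using less.prems by simp
      have "c \<otimes> a \<otimes> b [^] m = a \<otimes> (c \<otimes> b [^] m)" using c by (simp add: m_ac)
      then show "c \<otimes> a \<otimes> b [^] m \<in> I" using less.prems c ideal_mult_carrier[OF I] by simp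
    qed (use nm c in auto)
    have bc: "\<exists>k::nat. (c \<otimes> b) \<otimes> (a \<oplus> b) [^] k \<in> I"
    proof (rule less.hyps[of n m'])
      have "c \<otimes> b [^] m = c \<otimes> b \<otimes> b [^] m'" using c by (simp add: nm m_ac)
      then show "c \<otimes> b \<otimes> b [^] m' \<in> I" using less.prems by simp
      have "c \<otimes> b \<otimes> a [^] n = b \<otimes> (c \<otimes> a [^] n)" using c by (simp add: m_ac)
      then show "c \<otimes> b \<otimes> a [^] n \<in> I" using less.prems c ideal_mult_carrier[OF I] by simp
    qed (use nm c in auto)
    from ac bc obtain k l :: nat where kl: "(c \<otimes> a) \<otimes> (a \<oplus> b) [^] k \<in> I"
      "(c \<otimes> b) \<otimes> (a \<oplus> b) [^] l \<in> I" by blast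
    have "(a \<oplus> b) [^] l \<otimes> ((c \<otimes> a) \<otimes> (a \<oplus> b) [^] k) \<oplus>
      (a \<oplus> b) [^] k \<otimes> ((c \<otimes> b) \<otimes> (a \<oplus> b) [^] l) \<in> I"
      by (rule ideal_add_mem[OF I ideal_mult_carrier[OF I kl(1)] ideal_mult_carrier[OF I kl(2)]])
        (use c in simp_all)
    also have "(a \<oplus> b) [^] l \<otimes> ((c \<otimes> a) \<otimes> (a \<oplus> b) [^] k) \<oplus>
      (a \<oplus> b) [^] k \<otimes> ((c \<otimes> b) \<otimes> (a \<oplus> b) [^] l)
      = (c \<otimes> (a \<oplus> b)) \<otimes> ((a \<oplus> b) [^] k \<otimes> (a \<oplus> b) [^] l)"
      using c by (simp add: l_distr r_distr m_ac nat_pow_mult)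
    also have "\<dots> = c \<otimes> (a \<oplus> b) [^] Suc (k + l)"
      using c by (simp add: nat_pow_mult m_ac)
    finally show ?thesis by blast
  qed
qed

text \<open>The complement of a submonoid that is maximal among those disjoint from \<open>I\<close> is the
  desired prime: adjoining a further element to the submonoid makes it meet \<open>I\<close>.\<close>

lemma exists_min_prime_over:
  assumes I: "ideal I R" and S: "submonoid S R" and dis: "S \<inter> I = {}"
  shows "\<exists>Q. min_prime_over R Q I \<and> Q \<inter> S = {}"
proof -
  define \<A> where "\<A> = {T. submonoid T R \<and> S \<subseteq> T \<and> T \<inter> I = {}}"
  have "\<exists>T\<in>\<A>. \<forall>X\<in>\<A>. T \<subseteq> X \<longrightarrow> X = T"
  proof (rule subset_Zorn_nonempty)
    show "\<A> \<noteq> {}" using S dis by (auto simp: \<A>_def)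
    fix \<C> assume ne: "\<C> \<noteq> {}" and ch: "subset.chain \<A> \<C>"
    then have sub: "\<C> \<subseteq> \<A>" by (auto simp: subset_chain_def)
    have "submonoid (\<Union>\<C>) R"
    proof
      show "\<Union>\<C> \<subseteq> carrier R" using sub by (auto simp: \<A>_def submonoid_def)
      show "\<one> \<in> \<Union>\<C>" using sub ne by (auto simp: \<A>_def submonoid_def)
      fix x y assume "x \<in> \<Union>\<C>" "y \<in> \<Union>\<C>"
      then obtain X Y where XY: "X \<in> \<C>" "Y \<in> \<C>" "x \<in> X" "y \<in> Y" by blast
      then have "X \<subseteq> Y \<or> Y \<subseteq> X" using ch by (auto simp: subset_chain_def)
      then obtain Z where Z: "Z \<in> \<C>" "x \<in> Z" "y \<in> Z" using XY by blast
      then have "x \<otimes> y \<in> Z" using sub by (auto simp: \<A>_def submonoid_def)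
      then show "x \<otimes> y \<in> \<Union>\<C>" using Z by blast
    qed
    moreover have "S \<subseteq> \<Union>\<C>" using sub ne by (auto simp: \<A>_def)
    moreover have "\<Union>\<C> \<inter> I = {}" using sub by (auto simp: \<A>_def)
    ultimately show "\<Union>\<C> \<in> \<A>" by (simp add: \<A>_def)
  qed
  then obtain T where "T \<in> \<A>" and max: "\<And>X. X \<in> \<A> \<Longrightarrow> T \<subseteq> X \<Longrightarrow> X = T" by blast
  then have T: "submonoid T R" and ST: "S \<subseteq> T" and TI: "T \<inter> I = {}" by (auto simp: \<A>_def)
  interpret T: submonoid T R by (rule T)
  define Q where "Q = carrier R - T"
  have compl: "carrier R - Q = T" using T.subset by (auto simp: Q_def)
  have pow: "t [^] (n::nat) \<in> T" if "t \<in> T" for t n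
    using that by (induction n) auto
  have meets: "\<exists>n::nat. \<exists>s\<in>T. s \<otimes> a [^] n \<in> I" if a: "a \<in> Q" for a
  proof (rule ccontr)
    assume no: "\<not> ?thesis"
    have ac: "a \<in> carrier R" "a \<notin> T" using a by (auto simp: Q_def)
    \<comment> \<open>The submonoid generated by \<open>T\<close> and \<open>a\<close>. If it missed
      \<open>I\<close>, maximality would put \<open>a\<close> into \<open>T\<close>.\<close>
    define X where "X = {s \<otimes> a [^] n | s n. s \<in> T \<and> n \<in> (UNIV :: nat set)}"
    have TX: "T \<subseteq> X"
    proof
      fix t assume t: "t \<in> T"
      then have "t = t \<otimes> a [^] (0::nat)" using T.subset by auto
      then show "t \<in> X" using t unfolding X_def by blast
    qed
    have "submonoid X R"
    proof
      show "X \<subseteq> carrier R" using ac T.subset by (auto simp: X_def)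
      show "\<one> \<in> X" using TX T.one_closed by blast
      fix x y assume "x \<in> X" "y \<in> X"
      then obtain s t and n m :: nat where e: "x = s \<otimes> a [^] n" "y = t \<otimes> a [^] m" "s \<in> T" "t \<in> T"
        by (auto simp: X_def)
      have sc: "s \<in> carrier R" "t \<in> carrier R" using e T.subset by auto
      have "x \<otimes> y = (s \<otimes> t) \<otimes> (a [^] n \<otimes> a [^] m)"
        unfolding e(1,2) using ac sc by (simp add: m_ac)
      also have "\<dots> = (s \<otimes> t) \<otimes> a [^] (n + m)" using ac by (simp add: nat_pow_mult)
      finally show "x \<otimes> y \<in> X" using T.m_closed e unfolding X_def by blast
    qed
    moreover have "X \<inter> I = {}" using no by (auto simp: X_def)
    ultimately have "X = T" using max TX ST by (auto simp: \<A>_def)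
    moreover have "\<one> \<otimes> a [^] (1::nat) \<in> X" unfolding X_def using T.one_closed by blast
    ultimately show False using ac by simp
  qed
  have Qideal: "ideal Q R"
  proof (rule idealI_cring)
    show "Q \<subseteq> carrier R" by (auto simp: Q_def)
    show "\<zero> \<in> Q" using TI ideal_zero_mem[OF I] by (auto simp: Q_def)
  next
    fix a r assume a: "a \<in> Q" and r: "r \<in> carrier R"
    then have ac: "a \<in> carrier R" by (auto simp: Q_def)
    from meets[OF a] obtain n :: nat and s where s: "s \<in> T" "s \<otimes> a [^] n \<in> I" by blast
    show "r \<otimes> a \<in> Q"
    proof (rule ccontr)
      assume "r \<otimes> a \<notin> Q"
      then have "r \<otimes> a \<in> T" using ac r by (auto simp: Q_def)
      then have "s \<otimes> (r \<otimes> a) [^] n \<in> T" using pow s by auto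
      moreover have "s \<otimes> (r \<otimes> a) [^] n = r [^] n \<otimes> (s \<otimes> a [^] n)"
        using ac r s T.subset by (simp add: nat_pow_distrib m_ac subset_iff)
      then have "s \<otimes> (r \<otimes> a) [^] n \<in> I" using ideal_mult_carrier[OF I s(2)] r by simp
      ultimately show False using TI by blast
    qed
  next
    fix a b assume a: "a \<in> Q" and b: "b \<in> Q"
    then have c: "a \<in> carrier R" "b \<in> carrier R" by (auto simp: Q_def)
    from meets[OF a] meets[OF b] obtain n m :: nat and s t where
      st: "s \<in> T" "s \<otimes> a [^] n \<in> I" "t \<in> T" "t \<otimes> b [^] m \<in> I" by blast
    \<comment> \<open>Passing to the saturation absorbs the two different multipliers
      \<open>s\<close> and \<open>t\<close>, so that \<open>radical_add\<close> applies with the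
      common coefficient one.\<close>
    then have "\<one> \<otimes> a [^] n \<in> saturation R T I" "\<one> \<otimes> b [^] m \<in> saturation R T I"
      using c by (auto simp: saturation_def)
    from radical_add[OF saturation_ideal[OF T I] c one_closed this]
    obtain k :: nat where "\<one> \<otimes> (a \<oplus> b) [^] k \<in> saturation R T I" by blast
    then obtain u where u: "u \<in> T" "u \<otimes> (a \<oplus> b) [^] k \<in> I"
      using c by (auto simp: saturation_def)
    show "a \<oplus> b \<in> Q"
    proof (rule ccontr)
      assume "a \<oplus> b \<notin> Q"
      then have "a \<oplus> b \<in> T" using c by (auto simp: Q_def)
      then have "u \<otimes> (a \<oplus> b) [^] k \<in> T" using pow u by auto
      then show False using u TI by blast
    qed
  qed
  have "primeideal Q R"
  proof (rule primeidealI[OF Qideal cring_axioms])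
    show "carrier R \<noteq> Q" using T.one_closed T.subset unfolding Q_def by blast
    show "a \<in> Q \<or> b \<in> Q" if "a \<in> carrier R" "b \<in> carrier R" "a \<otimes> b \<in> Q" for a b
      using that by (auto simp: Q_def)
  qed
  moreover have "I \<subseteq> Q" using TI ideal.Icarr[OF I] by (auto simp: Q_def)
  ultimately have "min_prime_over R Q I"
    using meets unfolding min_prime_over_def compl by blast
  moreover have "Q \<inter> S = {}" using ST by (auto simp: Q_def)
  ultimately show ?thesis by blast
qed

lemma min_prime_over_prime: "min_prime_over R Q I \<Longrightarrow> primeideal Q R"
  and min_prime_over_subset: "min_prime_over R Q I \<Longrightarrow> I \<subseteq> Q"
  by (simp_all add: min_prime_over_def)

text \<open>Recovers ordinary minimality: the multiplier \<open>s\<close> avoids \<open>Q\<close>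
  and hence \<open>P\<close>, so primality of \<open>P\<close> removes first \<open>s\<close> and
  then the exponent.\<close>

lemma min_prime_over_minimal:
  assumes Q: "min_prime_over R Q I" and P: "primeideal P R" "I \<subseteq> P" "P \<subseteq> Q"
  shows "P = Q"
proof (rule equalityI[OF P(3)])
  interpret P: primeideal P R by (rule P)
  interpret Q: primeideal Q R by (rule min_prime_over_prime[OF Q])
  show "Q \<subseteq> P"
  proof
    fix a assume a: "a \<in> Q"
    then obtain n :: nat and s where s: "s \<in> carrier R" "s \<notin> Q" "s \<otimes> a [^] n \<in> I"
      using Q by (auto simp: min_prime_over_def)
    then have "s \<otimes> a [^] n \<in> P" "s \<notin> P" using P by auto
    then have "a [^] n \<in> P" using P.I_prime[of s "a [^] n"] s Q.Icarr[OF a] by auto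
    then show "a \<in> P" using P.pow_mem_iff[OF Q.Icarr[OF a], of n] by blast
  qed
qed

lemma min_prime_over_mono:
  assumes "min_prime_over R Q I" "I \<subseteq> K" "K \<subseteq> Q"
  shows "min_prime_over R Q K"
  using assms unfolding min_prime_over_def by blast

lemma exists_min_prime_over_below:
  assumes "ideal I R" "primeideal P R" "I \<subseteq> P"
  obtains Q where "min_prime_over R Q I" "Q \<subseteq> P"
proof -
  have "(carrier R - P) \<inter> I = {}" using assms by blast
  from exists_min_prime_over[OF assms(1) submonoid_compl_prime[OF assms(2)] this]
  obtain Q where Q: "min_prime_over R Q I" "Q \<inter> (carrier R - P) = {}" by blast
  then have "Q \<subseteq> P"
    using ideal_subset_carrier[OF primeideal.axioms(1)[OF min_prime_over_prime[OF Q(1)]]] by blast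
  then show ?thesis using Q that by blast
qed

section \<open>TA-ideals and their minimal primes\<close>

lemma TA_ideal_ideal: "TA_ideal R J \<Longrightarrow> ideal J R"
  by (simp add: TA_ideal_def)

lemma TA_idealD:
  assumes "TA_ideal R J" "a \<in> carrier R" "b \<in> carrier R" "c \<in> carrier R" "a \<otimes> b \<otimes> c \<in> J"
  shows "a \<otimes> b \<in> J \<or> a \<otimes> c \<in> J \<or> b \<otimes> c \<in> J"
  using assms by (auto simp: TA_ideal_def)

text \<open>Reading a power as \<open>a \<otimes> a \<otimes> a [^] m\<close>, the TA property
  either gives the square at once or lowers the exponent by one.\<close>

lemma TA_ideal_square:
  assumes J: "TA_ideal R J" and a: "a \<in> carrier R"
  shows "a [^] (n::nat) \<in> J \<Longrightarrow> a \<otimes> a \<in> J"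
proof (induction n)
  case 0
  then show ?case using ideal_mult_carrier[OF TA_ideal_ideal[OF J], of \<one> "a \<otimes> a"] a by simp
next
  case (Suc n)
  show ?case
  proof (cases n)
    case 0
    then show ?thesis
      using Suc.prems ideal_mult_carrier[OF TA_ideal_ideal[OF J], of a a] a by simp
  next
    case (Suc m)
    then have "a \<otimes> a \<otimes> a [^] m \<in> J" using \<open>a [^] Suc n \<in> J\<close> a by (simp add: m_ac)
    then have "a \<otimes> a \<in> J \<or> a \<otimes> a [^] m \<in> J"
      using TA_idealD[OF J a a, of "a [^] m"] a by auto
    then show ?thesis using Suc.IH Suc a by (auto simp: m_comm)
  qed
qed

text \<open>The product of \<open>a\<close>, \<open>b\<close> and \<open>a \<oplus> b\<close> lies
  in \<open>J\<close>; each pair allowed by the TA property yields \<open>a \<otimes> b\<close>, if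
  necessary after cancelling a square. Together with \<open>TA_ideal_square\<close>, any two
  elements of the radical have their product in \<open>J\<close>.\<close>

lemma TA_ideal_mult_of_squares:
  assumes J: "TA_ideal R J" and a: "a \<in> carrier R" "a \<otimes> a \<in> J"
    and b: "b \<in> carrier R" "b \<otimes> b \<in> J"
  shows "a \<otimes> b \<in> J"
proof -
  interpret J: ideal J R by (rule TA_ideal_ideal[OF J])
  note c = a(1) b(1)
  have "b \<otimes> (a \<otimes> a) \<oplus> a \<otimes> (b \<otimes> b) \<in> J"
    by (rule ideal_add_mem[OF J.is_ideal J.I_l_closed[OF a(2) b(1)] J.I_l_closed[OF b(2) a(1)]])
  also have "b \<otimes> (a \<otimes> a) \<oplus> a \<otimes> (b \<otimes> b) = a \<otimes> b \<otimes> (a \<oplus> b)"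
    using c by (simp add: r_distr m_ac)
  finally consider "a \<otimes> b \<in> J" | "a \<otimes> (a \<oplus> b) \<in> J" | "b \<otimes> (a \<oplus> b) \<in> J"
    using TA_idealD[OF J a(1) b(1), of "a \<oplus> b"] c by auto
  then show ?thesis
  proof cases
    case 2
    then have "a \<otimes> b \<oplus> a \<otimes> a \<in> J" using c by (simp add: r_distr a_ac)
    then show ?thesis using J.l_cancel_closed a c by blast
  next
    case 3
    then have "a \<otimes> b \<oplus> b \<otimes> b \<in> J" using c by (simp add: r_distr m_ac)
    then show ?thesis using J.l_cancel_closed b c by blast
  qed
qed

lemma min_prime_over_TA_ideal_square:
  assumes Q: "min_prime_over R Q J" and J: "TA_ideal R J" and a: "a \<in> Q"
  obtains s where "s \<in> carrier R - Q" "(s \<otimes> a) \<otimes> (s \<otimes> a) \<in> J"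
proof -
  interpret Q: primeideal Q R by (rule min_prime_over_prime[OF Q])
  obtain n :: nat and s where s: "s \<in> carrier R - Q" "s \<otimes> a [^] n \<in> J"
    using Q a by (auto simp: min_prime_over_def)
  have c: "s \<in> carrier R" "a \<in> carrier R" using s Q.Icarr[OF a] by auto
  \<comment> \<open>Multiplying by \<open>s [^] n\<close> and by \<open>a\<close> produces a genuine
    power of \<open>s \<otimes> a\<close>, to which \<open>TA_ideal_square\<close> applies.\<close>
  have "s [^] n \<otimes> (s \<otimes> a [^] n) \<in> J"
    using s c ideal_mult_carrier[OF TA_ideal_ideal[OF J]] by simp
  then have "a \<otimes> (s [^] n \<otimes> (s \<otimes> a [^] n)) \<in> J"
    using c ideal_mult_carrier[OF TA_ideal_ideal[OF J]] by simp
  also have "a \<otimes> (s [^] n \<otimes> (s \<otimes> a [^] n)) = (s \<otimes> a) [^] Suc n"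
    using c by (simp add: nat_pow_distrib m_ac)
  finally show ?thesis using TA_ideal_square[OF J, of "s \<otimes> a"] c s that by blast
qed

text \<open>Local form of the statement on radicals: locally at \<open>Q\<close> the radical of
  \<open>J\<close> is \<open>Q\<close>, and its square lies in \<open>J\<close>.\<close>

lemma min_prime_over_TA_ideal_mult:
  assumes Q: "min_prime_over R Q J" and J: "TA_ideal R J" and a: "a \<in> Q" and b: "b \<in> Q"
  shows "a \<otimes> b \<in> saturation R (carrier R - Q) J"
proof -
  interpret Q: primeideal Q R by (rule min_prime_over_prime[OF Q])
  obtain s t where s: "s \<in> carrier R - Q" "(s \<otimes> a) \<otimes> (s \<otimes> a) \<in> J"
    and t: "t \<in> carrier R - Q" "(t \<otimes> b) \<otimes> (t \<otimes> b) \<in> J"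
    using min_prime_over_TA_ideal_square[OF Q J] a b by metis
  note c = Q.Icarr[OF a] Q.Icarr[OF b]
  have "(s \<otimes> a) \<otimes> (t \<otimes> b) \<in> J"
    by (rule TA_ideal_mult_of_squares[OF J]) (use s t c in auto)
  moreover have "(s \<otimes> a) \<otimes> (t \<otimes> b) = (s \<otimes> t) \<otimes> (a \<otimes> b)"
    using c s t by (simp add: m_ac)
  moreover have "s \<otimes> t \<in> carrier R - Q"
    using s t Q.I_prime[of s t] by auto
  ultimately show ?thesis using c by (auto simp: saturation_def)
qed

text \<open>A second prime improves the square to the element itself: in the product of
  \<open>a\<close>, \<open>a\<close> and \<open>s \<otimes> s\<close> the pair
  \<open>a \<otimes> a\<close> is excluded by \<open>P2\<close>, so a multiple of \<open>a\<close>
  by a power of \<open>s\<close> remains.\<close>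

lemma min_prime_over_TA_ideal_colon:
  assumes P1: "min_prime_over R P1 J" and P2: "primeideal P2 R" "J \<subseteq> P2"
    and J: "TA_ideal R J" and a: "a \<in> P1" "a \<notin> P2"
  obtains s where "s \<in> carrier R - P1" "s \<otimes> a \<in> J"
proof -
  interpret P1: primeideal P1 R by (rule min_prime_over_prime[OF P1])
  interpret P2: primeideal P2 R by (rule P2)
  obtain s where s: "s \<in> carrier R - P1" "(s \<otimes> a) \<otimes> (s \<otimes> a) \<in> J"
    using min_prime_over_TA_ideal_square[OF P1 J a(1)] by blast
  have c: "s \<in> carrier R" "a \<in> carrier R" using s P1.Icarr[OF a(1)] by auto
  have "a \<otimes> a \<otimes> (s \<otimes> s) \<in> J" using s c by (simp add: m_ac)
  moreover have "a \<otimes> a \<notin> J" using P2 P2.I_prime[of a a] c a by blast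
  ultimately have "a \<otimes> (s \<otimes> s) \<in> J" using TA_idealD[OF J c(2) c(2), of "s \<otimes> s"] c by auto
  moreover have "s \<otimes> s \<in> carrier R - P1" using s P1.I_prime[of s s] by auto
  ultimately show ?thesis using that[of "s \<otimes> s"] c by (simp add: m_comm)
qed

text \<open>With \<open>s \<otimes> a\<close> and \<open>t \<otimes> b\<close> in \<open>J\<close>,
  the product of \<open>a\<close>, \<open>b\<close> and \<open>s \<oplus> t\<close> is in
  \<open>J\<close>. Any pair other than \<open>a \<otimes> b\<close> would put
  \<open>a \<otimes> t\<close> into \<open>P2\<close> or \<open>b \<otimes> s\<close> into
  \<open>P1\<close>, against primality.\<close>

lemma mult_mem_TA_ideal_aux:
  assumes P1: "min_prime_over R P1 J" and P2: "min_prime_over R P2 J" and J: "TA_ideal R J"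
    and a: "a \<in> P1" "a \<notin> P2" and b: "b \<in> P2" "b \<notin> P1"
  shows "a \<otimes> b \<in> J"
proof -
  interpret J: ideal J R by (rule TA_ideal_ideal[OF J])
  interpret P1: primeideal P1 R by (rule min_prime_over_prime[OF P1])
  interpret P2: primeideal P2 R by (rule min_prime_over_prime[OF P2])
  note J1 = min_prime_over_subset[OF P1] and J2 = min_prime_over_subset[OF P2]
  obtain s where s: "s \<in> carrier R - P1" "s \<otimes> a \<in> J"
    using min_prime_over_TA_ideal_colon[OF P1 P2.primeideal J2 J a] by blast
  obtain t where t: "t \<in> carrier R - P2" "t \<otimes> b \<in> J"
    using min_prime_over_TA_ideal_colon[OF P2 P1.primeideal J1 J b] by blast
  have c: "a \<in> carrier R" "b \<in> carrier R" "s \<in> carrier R" "t \<in> carrier R"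
    using P1.Icarr[OF a(1)] P2.Icarr[OF b(1)] s t by auto
  have "b \<otimes> (s \<otimes> a) \<oplus> a \<otimes> (t \<otimes> b) \<in> J"
    by (rule ideal_add_mem[OF J.is_ideal J.I_l_closed[OF s(2) c(2)] J.I_l_closed[OF t(2) c(1)]])
  also have "b \<otimes> (s \<otimes> a) \<oplus> a \<otimes> (t \<otimes> b) = a \<otimes> b \<otimes> (s \<oplus> t)"
    using c by (simp add: r_distr m_ac)
  finally consider "a \<otimes> b \<in> J" | "a \<otimes> (s \<oplus> t) \<in> J" | "b \<otimes> (s \<oplus> t) \<in> J"
    using TA_idealD[OF J c(1,2), of "s \<oplus> t"] c by auto
  then show ?thesis
  proof cases
    case 2
    then have "a \<otimes> t \<oplus> s \<otimes> a \<in> J" using c by (simp add: r_distr m_ac a_ac)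
    then have "a \<otimes> t \<in> J" by (rule J.l_cancel_closed) (use s c in auto)
    then show ?thesis using P2.I_prime[of a t] J2 a t c by auto
  next
    case 3
    then have "b \<otimes> s \<oplus> t \<otimes> b \<in> J" using c by (simp add: r_distr m_ac a_ac)
    then have "b \<otimes> s \<in> J" by (rule J.l_cancel_closed) (use t c in auto)
    then show ?thesis using P1.I_prime[of b s] J1 b s c by auto
  qed
qed

text \<open>An element of both primes is moved out of one of them by adding an element that lies
  only in the other. The previous case covers the sum and the added element, hence their difference.
  The left factor is freed first, then the right one.\<close>

lemma mult_mem_TA_ideal:
  assumes P1: "min_prime_over R P1 J" and P2: "min_prime_over R P2 J" and J: "TA_ideal R J"
    and ne: "P1 \<noteq> P2" and x: "x \<in> P1" and y: "y \<in> P2"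
  shows "x \<otimes> y \<in> J"
proof -
  interpret J: ideal J R by (rule TA_ideal_ideal[OF J])
  interpret P1: primeideal P1 R by (rule min_prime_over_prime[OF P1])
  interpret P2: primeideal P2 R by (rule min_prime_over_prime[OF P2])
  obtain a where a: "a \<in> P1" "a \<notin> P2"
    using min_prime_over_minimal[OF P2 P1.primeideal min_prime_over_subset[OF P1]] ne by blast
  obtain b where b: "b \<in> P2" "b \<notin> P1"
    using min_prime_over_minimal[OF P1 P2.primeideal min_prime_over_subset[OF P2]] ne by blast
  note aux = mult_mem_TA_ideal_aux[OF P1 P2 J]
  note c = P1.Icarr[OF a(1)] P2.Icarr[OF b(1)] P1.Icarr[OF x] P2.Icarr[OF y]
  have left: "x' \<otimes> b' \<in> J" if x': "x' \<in> P1" and b': "b' \<in> P2" "b' \<notin> P1" for x' b'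
  proof (cases "x' \<in> P2")
    case True
    note c = c P1.Icarr[OF x'] P2.Icarr[OF b'(1)]
    have "x' \<oplus> a \<notin> P2"
      using P2.l_cancel_closed[of a x'] True a c by (auto simp: a_comm)
    then have "(x' \<oplus> a) \<otimes> b' \<in> J" using aux[of "x' \<oplus> a" b'] x' a b' by auto
    then have "x' \<otimes> b' \<oplus> a \<otimes> b' \<in> J" using c by (simp add: l_distr)
    then show ?thesis by (rule J.l_cancel_closed) (use aux[OF a b'] c in auto)
  qed (use aux x' b' in auto)
  show ?thesis
  proof (cases "y \<in> P1")
    case True
    have "y \<oplus> b \<notin> P1"
      using P1.l_cancel_closed[of b y] True b c by (auto simp: a_comm)
    then have "x \<otimes> (y \<oplus> b) \<in> J" using left[of x "y \<oplus> b"] x y b by auto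
    then have "x \<otimes> y \<oplus> x \<otimes> b \<in> J" using c by (simp add: r_distr)
    then show ?thesis by (rule J.l_cancel_closed) (use left[OF x b] c in auto)
  qed (use left x y in auto)
qed

text \<open>Two distinct minimal primes have their product inside \<open>J\<close>, so any further
  minimal prime contains one of them and equals it by minimality.\<close>

lemma finite_min_primes_over_TA_ideal:
  assumes J: "TA_ideal R J"
  shows "finite {P. min_prime_over R P J}"
proof (cases "\<exists>P1 P2. min_prime_over R P1 J \<and> min_prime_over R P2 J \<and> P1 \<noteq> P2")
  case True
  then obtain P1 P2 where P: "min_prime_over R P1 J" "min_prime_over R P2 J" "P1 \<noteq> P2" by blast
  have "P3 \<in> {P1, P2}" if P3: "min_prime_over R P3 J" for P3
  proof -
    interpret P1: primeideal P1 R by (rule min_prime_over_prime[OF P(1)])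
    interpret P2: primeideal P2 R by (rule min_prime_over_prime[OF P(2)])
    interpret P3: primeideal P3 R by (rule min_prime_over_prime[OF P3])
    have "x \<otimes> y \<in> P3" if "x \<in> P1" "y \<in> P2" for x y
      using mult_mem_TA_ideal[OF P(1,2) J P(3)] that min_prime_over_subset[OF P3] by blast
    then have "P1 \<subseteq> P3 \<or> P2 \<subseteq> P3"
      using P3.I_prime P1.Icarr P2.Icarr by (meson subsetI)
    then show ?thesis
      using min_prime_over_minimal[OF P3 P1.primeideal min_prime_over_subset[OF P(1)]]
        min_prime_over_minimal[OF P3 P2.primeideal min_prime_over_subset[OF P(2)]] by blast
  qed
  then have "{P. min_prime_over R P J} \<subseteq> {P1, P2}" by blast
  then show ?thesis by (rule finite_subset) simp
next
  case False
  then obtain P0 where "{P. min_prime_over R P J} \<subseteq> {P0}" by blast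
  then show ?thesis by (rule finite_subset) simp
qed

section \<open>Products of lists of ideals\<close>

lemma ideal_list_prod_Nil [simp]: "ideal_list_prod R [] = carrier R"
  and ideal_list_prod_Cons [simp]:
    "ideal_list_prod R (J # Js) = ideal_prod R J (ideal_list_prod R Js)"
  by (simp_all add: ideal_list_prod_def)

lemma ideal_prod_subsetI:
  assumes "ideal K R" "\<And>i j. i \<in> I \<Longrightarrow> j \<in> J \<Longrightarrow> i \<otimes> j \<in> K"
  shows "I \<cdot> J \<subseteq> K"
proof
  fix x assume "x \<in> I \<cdot> J"
  then show "x \<in> K"
    by induction (auto intro: assms(2) ideal_add_mem[OF assms(1)])
qed

lemma ideal_prod_mono: "I \<subseteq> I' \<Longrightarrow> J \<subseteq> J' \<Longrightarrow> I \<cdot> J \<subseteq> I' \<cdot> J'"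
proof
  fix x assume "I \<subseteq> I'" "J \<subseteq> J'" "x \<in> I \<cdot> J"
  from this(3,1,2) show "x \<in> I' \<cdot> J'"
    by induction (auto intro: ideal_prod.intros)
qed

lemma ideal_list_prod_ideal: "\<forall>J\<in>set Js. ideal J R \<Longrightarrow> ideal (ideal_list_prod R Js) R"
  by (induction Js) (auto intro: oneideal ideal_prod_is_ideal)

lemma ideal_list_prod_subset:
  "\<forall>J\<in>set Js. ideal J R \<Longrightarrow> J \<in> set Js \<Longrightarrow> ideal_list_prod R Js \<subseteq> J"
proof (induction Js)
  case (Cons K Js)
  then have "ideal_list_prod R (K # Js) \<subseteq> K \<inter> ideal_list_prod R Js"
    using ideal_prod_inter ideal_list_prod_ideal by simp
  then show ?case using Cons by (cases "J = K") auto
qed simp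

lemma (in primeideal) ideal_list_prod_subset_prime:
  "\<forall>J\<in>set Js. ideal J R \<Longrightarrow> ideal_list_prod R Js \<subseteq> I \<Longrightarrow> \<exists>J\<in>set Js. J \<subseteq> I"
proof (induction Js)
  case Nil
  then show ?case using I_notcarr Icarr by auto
next
  case (Cons K Js)
  show ?case
  proof (rule ccontr)
    assume no: "\<not> ?case"
    then obtain a b where ab: "a \<in> K" "a \<notin> I" "b \<in> ideal_list_prod R Js" "b \<notin> I"
      using Cons by auto
    have "a \<otimes> b \<in> I" using ab Cons.prems(2) by (auto intro: ideal_prod.prod)
    moreover have "a \<in> carrier R" "b \<in> carrier R"
      using ab Cons.prems(1) ideal_list_prod_ideal[of Js] by (auto dest: ideal.Icarr)
    ultimately show False using I_prime ab by blast
  qed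
qed

text \<open>A minimal prime of the product contains some factor, and it is minimal over that factor
  because the factor contains the product.\<close>

lemma finite_min_primes_over_ideal_list_prod:
  assumes "\<forall>J\<in>set Js. TA_ideal R J"
  shows "finite {P. min_prime_over R P (ideal_list_prod R Js)}"
proof (rule finite_subset)
  have id: "\<forall>J\<in>set Js. ideal J R" using assms TA_ideal_ideal by blast
  show "{P. min_prime_over R P (ideal_list_prod R Js)} \<subseteq> (\<Union>J\<in>set Js. {P. min_prime_over R P J})"
  proof clarify
    fix P assume P: "min_prime_over R P (ideal_list_prod R Js)"
    interpret P: primeideal P R by (rule min_prime_over_prime[OF P])
    obtain J where J: "J \<in> set Js" "J \<subseteq> P"
      using P.ideal_list_prod_subset_prime[OF id min_prime_over_subset[OF P]] by blast
    then have "min_prime_over R P J"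
      using min_prime_over_mono[OF P ideal_list_prod_subset[OF id J(1)]] by blast
    then show "P \<in> (\<Union>J\<in>set Js. {P. min_prime_over R P J})" using J by blast
  qed
  show "finite (\<Union>J\<in>set Js. {P. min_prime_over R P J})"
    using assms finite_min_primes_over_TA_ideal by blast
qed

section \<open>Prime avoidance\<close>

text \<open>Multiply an element of \<open>I - P\<close> by one element of \<open>J - P\<close> for
  each \<open>J\<close> in \<open>F\<close>; primality keeps the product outside
  \<open>P\<close>.\<close>

lemma exists_mem_Inter_not_prime:
  assumes P: "primeideal P R" and I: "ideal I R" "\<not> I \<subseteq> P"
  shows "finite F \<Longrightarrow> (\<And>J. J \<in> F \<Longrightarrow> ideal J R \<and> \<not> J \<subseteq> P) \<Longrightarrow> \<exists>z\<in>I - P. \<forall>J\<in>F. z \<in> J"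
proof (induction F rule: finite_induct)
  case empty
  then show ?case using I by blast
next
  case (insert K F)
  interpret P: primeideal P R by (rule P)
  obtain z where z: "z \<in> I - P" "\<forall>J\<in>F. z \<in> J" using insert by blast
  obtain k where k: "k \<in> K" "k \<notin> P" using insert.prems[of K] by blast
  have c: "k \<in> carrier R" "z \<in> carrier R"
    using k z I insert.prems[of K] by (auto dest: ideal.Icarr)
  have "k \<otimes> z \<in> I" "\<forall>J\<in>F. k \<otimes> z \<in> J"
    using z c I insert.prems ideal_mult_carrier by auto
  moreover have "k \<otimes> z \<in> K"
    using ideal.I_r_closed[of K R k z] insert.prems[of K] k c by auto
  moreover have "k \<otimes> z \<notin> P" using P.I_prime[OF c] k z by blast
  ultimately show ?case by blast
qed

text \<open>If the \<open>x\<close> found for \<open>F\<close> lies in the new prime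
  \<open>P\<close>, it is corrected by some \<open>z\<close> in \<open>I\<close> that avoids
  \<open>P\<close> and lies in every member of \<open>F\<close>. Such a \<open>z\<close> exists
  because the primes are pairwise incomparable.\<close>

lemma prime_avoidance:
  assumes I: "ideal I R"
  shows "finite F \<Longrightarrow> (\<And>P. P \<in> F \<Longrightarrow> primeideal P R \<and> \<not> I \<subseteq> P) \<Longrightarrow>
    (\<And>P P'. P \<in> F \<Longrightarrow> P' \<in> F \<Longrightarrow> P \<subseteq> P' \<Longrightarrow> P = P') \<Longrightarrow> \<exists>x\<in>I. \<forall>P\<in>F. x \<notin> P"
proof (induction F rule: finite_induct)
  case empty
  then show ?case using ideal_zero_mem[OF I] by blast
next
  case (insert P F)
  have P: "primeideal P R" "\<not> I \<subseteq> P" using insert.prems(1)[of P] by auto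
  interpret P: primeideal P R by (rule P)
  have "\<exists>x\<in>I. \<forall>P\<in>F. x \<notin> P" by (rule insert.IH) (use insert.prems in auto)
  then obtain x where x: "x \<in> I" "\<forall>P\<in>F. x \<notin> P" by blast
  show ?case
  proof (cases "x \<in> P")
    case True
    have "\<exists>z\<in>I - P. \<forall>J\<in>F. z \<in> J"
    proof (rule exists_mem_Inter_not_prime[OF P(1) I P(2) insert.hyps(1)])
      fix J assume J: "J \<in> F"
      then have "J \<noteq> P" using insert.hyps by blast
      then show "ideal J R \<and> \<not> J \<subseteq> P"
        using J insert.prems(1)[of J] insert.prems(2)[of J P] primeideal.axioms(1)[of J R] by auto
    qed
    then obtain z where z: "z \<in> I" "z \<notin> P" "\<forall>J\<in>F. z \<in> J" by blast
    have c: "x \<in> carrier R" "z \<in> carrier R" using x z I by (auto dest: ideal.Icarr)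
    have "z \<oplus> x \<notin> P" using P.l_cancel_closed[OF _ True c(2)] z by blast
    moreover have "z \<oplus> x \<notin> J" if J: "J \<in> F" for J
    proof
      assume "z \<oplus> x \<in> J"
      moreover have "ideal J R" using insert.prems(1)[of J] J primeideal.axioms(1) by blast
      ultimately have "x \<in> J"
        using ideal.l_cancel_closed[of J R x z] z J c by (simp add: a_comm)
      then show False using x J by blast
    qed
    moreover have "z \<oplus> x \<in> I" using ideal_add_mem[OF I] x z by blast
    ultimately show ?thesis by blast
  qed (use x in blast)
qed

section \<open>Adjoining several elements and their powers\<close>

lemma adjoin_commute:
  assumes "ideal I R" "x \<in> carrier R" "y \<in> carrier R"
  shows "adjoin R (adjoin R I x) y = adjoin R (adjoin R I y) x"
proof -
  have *: "adjoin R (adjoin R I x) y \<subseteq> adjoin R (adjoin R I y) x"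
    if "x \<in> carrier R" "y \<in> carrier R" for x y
  proof (rule adjoin_subset)
    note Iy = adjoin_ideal[OF assms(1) that(2)]
    show "ideal (adjoin R (adjoin R I y) x) R" using adjoin_ideal[OF Iy that(1)] .
    show "y \<in> adjoin R (adjoin R I y) x"
      using subset_adjoin[OF ideal_subset_carrier[OF Iy] that(1)] mem_adjoin[OF assms(1) that(2)] by blast
    show "adjoin R I x \<subseteq> adjoin R (adjoin R I y) x"
    proof (rule adjoin_subset)
      show "ideal (adjoin R (adjoin R I y) x) R" using adjoin_ideal[OF Iy that(1)] .
      show "I \<subseteq> adjoin R (adjoin R I y) x"
        using subset_adjoin[OF ideal_subset_carrier[OF Iy] that(1)]
          subset_adjoin[OF ideal_subset_carrier[OF assms(1)] that(2)] by blast
      show "x \<in> adjoin R (adjoin R I y) x" by (rule mem_adjoin[OF Iy that(1)])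
    qed
  qed
  show ?thesis using *[of x y] *[of y x] assms by blast
qed

lemma adjoin_nat_pow:
  assumes I: "ideal I R" and x: "x \<in> carrier R" and z: "z \<in> adjoin R I x"
  shows "z [^] (m::nat) \<in> adjoin R I (x [^] m)"
proof (induction m)
  case 0
  show ?case using mem_adjoin[OF I, of \<one>] by simp
next
  case (Suc m)
  obtain i r where i: "z = i \<oplus> r \<otimes> x" "i \<in> I" "r \<in> carrier R"
    using z by (auto simp: adjoin_def)
  obtain j q where j: "z [^] m = j \<oplus> q \<otimes> x [^] m" "j \<in> I" "q \<in> carrier R"
    using Suc by (auto simp: adjoin_def)
  note c = x i(3) j(3) ideal.Icarr[OF I i(2)] ideal.Icarr[OF I j(2)]
  have zm: "z [^] m \<in> carrier R" using c i by simp
  have "z [^] m \<otimes> (r \<otimes> x) = (r \<otimes> x) \<otimes> j \<oplus> (q \<otimes> r) \<otimes> x [^] Suc m"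
    unfolding j(1) using c by (simp add: l_distr r_distr m_ac)
  moreover have "z [^] Suc m = z [^] m \<otimes> i \<oplus> z [^] m \<otimes> (r \<otimes> x)"
    using zm c by (simp add: r_distr[symmetric] i(1)[symmetric])
  ultimately have "z [^] Suc m = (z [^] m \<otimes> i \<oplus> (r \<otimes> x) \<otimes> j) \<oplus> (q \<otimes> r) \<otimes> x [^] Suc m"
    using zm c by (simp add: a_assoc)
  moreover have "z [^] m \<otimes> i \<oplus> (r \<otimes> x) \<otimes> j \<in> I"
    by (rule ideal_add_mem[OF I ideal_mult_carrier[OF I i(2)] ideal_mult_carrier[OF I j(2)]])
      (use c i j in auto)
  ultimately show ?case using c unfolding adjoin_def by blast
qed

text \<open>The ideals \<open>I + (x)\<close> and \<open>I + (x^m)\<close> have the same radical: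
  the membership of \<open>s \<otimes> a [^] n\<close> is raised to the power
  \<open>m\<close>.\<close>

lemma min_prime_over_adjoin_pow:
  assumes Q: "min_prime_over R Q (adjoin R I x)" and I: "ideal I R" and x: "x \<in> carrier R"
    and m: "(m::nat) \<noteq> 0"
  shows "min_prime_over R Q (adjoin R I (x [^] m))"
  unfolding min_prime_over_def
proof (intro conjI ballI)
  interpret Q: primeideal Q R by (rule min_prime_over_prime[OF Q])
  show "primeideal Q R" by (rule Q.primeideal)
  have sub: "adjoin R I x \<subseteq> Q" by (rule min_prime_over_subset[OF Q])
  then have xQ: "x \<in> Q" "I \<subseteq> Q"
    using mem_adjoin[OF I x] subset_adjoin[OF ideal_subset_carrier[OF I] x] by auto
  show "adjoin R I (x [^] m) \<subseteq> Q"
    by (rule adjoin_subset[OF Q.is_ideal xQ(2)]) (use Q.pow_mem_iff[OF x] xQ m in auto)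
  fix a assume a: "a \<in> Q"
  then obtain n :: nat and s where s: "s \<in> carrier R - Q" "s \<otimes> a [^] n \<in> adjoin R I x"
    using Q by (auto simp: min_prime_over_def)
  have c: "s \<in> carrier R" "a \<in> carrier R" using s Q.Icarr[OF a] by auto
  have "(s \<otimes> a [^] n) [^] m \<in> adjoin R I (x [^] m)" by (rule adjoin_nat_pow[OF I x s(2)])
  then have "s [^] m \<otimes> a [^] (n * m) \<in> adjoin R I (x [^] m)"
    using c by (simp add: nat_pow_distrib nat_pow_pow)
  moreover have "s [^] m \<in> carrier R - Q" using s Q.pow_mem_iff[OF c(1)] by auto
  ultimately show "\<exists>n::nat. \<exists>s\<in>carrier R - Q. s \<otimes> a [^] n \<in> adjoin R I (x [^] m)" by blast
qed

section \<open>Powers of an ideal and local bounds for products\<close>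

lemma ideal_power_ideal: "ideal I R \<Longrightarrow> ideal (ideal_power R I n) R"
  by (induction n) (auto intro: oneideal ideal_prod_is_ideal)

lemma ideal_power_antimono:
  assumes "ideal I R" "k \<le> l"
  shows "ideal_power R I l \<subseteq> ideal_power R I k"
  using assms(2)
proof (induction l rule: dec_induct)
  case (step l)
  have "ideal_power R I (Suc l) \<subseteq> ideal_power R I l"
    using ideal_prod_inter[OF assms(1) ideal_power_ideal[OF assms(1), of l]] by simp
  then show ?case using step.IH by (rule subset_trans)
qed simp

lemma nat_pow_mem_ideal_power:
  assumes "ideal I R" "x \<in> I"
  shows "x [^] n \<in> ideal_power R I n"
proof (induction n)
  case (Suc n)
  have "x \<otimes> x [^] n \<in> ideal_power R I (Suc n)"
    using ideal_prod.prod[OF assms(2) Suc] by simp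
  then show ?case using ideal.Icarr[OF assms] by (simp add: m_comm)
qed simp

lemma ideal_prod_saturation:
  assumes T: "submonoid T R" and I: "ideal I R" and J: "ideal J R"
    and A: "A \<subseteq> saturation R T I" and B: "B \<subseteq> saturation R T J"
  shows "A \<cdot> B \<subseteq> saturation R T (I \<cdot> J)"
proof (rule ideal_prod_subsetI[OF saturation_ideal[OF T ideal_prod_is_ideal[OF I J]]])
  interpret T: submonoid T R by (rule T)
  fix a b assume "a \<in> A" "b \<in> B"
  then have "a \<in> saturation R T I" "b \<in> saturation R T J" using A B by auto
  then obtain s t where st: "s \<in> T" "t \<in> T" "s \<otimes> a \<in> I" "t \<otimes> b \<in> J"
    "a \<in> carrier R" "b \<in> carrier R" by (auto simp: saturation_def)
  have "(s \<otimes> a) \<otimes> (t \<otimes> b) \<in> I \<cdot> J" using st by (auto intro: ideal_prod.prod)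
  also have "(s \<otimes> a) \<otimes> (t \<otimes> b) = (s \<otimes> t) \<otimes> (a \<otimes> b)"
    using st T.subset by (simp add: m_ac subset_iff)
  finally have "(s \<otimes> t) \<otimes> (a \<otimes> b) \<in> I \<cdot> J" .
  moreover have "s \<otimes> t \<in> T" using st by auto
  ultimately show "a \<otimes> b \<in> saturation R T (I \<cdot> J)"
    using st(5,6) unfolding saturation_def by blast
qed

text \<open>Only the factors inside \<open>Q\<close> matter; \<open>l\<close> is their number, and each of them contains
  \<open>Q\<^sup>2\<close> up to localization at \<open>Q\<close>.\<close>

lemma ideal_list_prod_power_bounds:
  assumes Q: "primeideal Q R"
  shows "(\<And>J. J \<in> set Js \<Longrightarrow> TA_ideal R J) \<Longrightarrow>
    (\<And>J. J \<in> set Js \<Longrightarrow> J \<subseteq> Q \<Longrightarrow> min_prime_over R Q J) \<Longrightarrow>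
    \<exists>l. ideal_list_prod R Js \<subseteq> ideal_power R Q l \<and>
      ideal_power R Q (2 * l) \<subseteq> saturation R (carrier R - Q) (ideal_list_prod R Js)"
proof (induction Js)
  case Nil
  have "ideal_list_prod R [] \<subseteq> ideal_power R Q 0 \<and>
      ideal_power R Q (2 * 0) \<subseteq> saturation R (carrier R - Q) (ideal_list_prod R [])"
    using subset_saturation[OF submonoid_compl_prime[OF Q] oneideal] by simp
  then show ?case by blast
next
  case (Cons J Js)
  interpret Q: primeideal Q R by (rule Q)
  note T = submonoid_compl_prime[OF Q]
  have J: "TA_ideal R J" "ideal J R" using Cons.prems(1)[of J] TA_ideal_ideal by auto
  have Js: "ideal (ideal_list_prod R Js) R"
    using Cons.prems(1) TA_ideal_ideal by (intro ideal_list_prod_ideal) auto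
  have "\<exists>l. ideal_list_prod R Js \<subseteq> ideal_power R Q l \<and>
      ideal_power R Q (2 * l) \<subseteq> saturation R (carrier R - Q) (ideal_list_prod R Js)"
    by (rule Cons.IH) (use Cons.prems in auto)
  then obtain l where l: "ideal_list_prod R Js \<subseteq> ideal_power R Q l"
    "ideal_power R Q (2 * l) \<subseteq> saturation R (carrier R - Q) (ideal_list_prod R Js)" by blast
  show ?case
  proof (cases "J \<subseteq> Q")
    case True
    then have min: "min_prime_over R Q J" using Cons.prems(2)[of J] by auto
    have "Q \<cdot> Q \<subseteq> saturation R (carrier R - Q) J"
      using min_prime_over_TA_ideal_mult[OF min J(1)]
      by (intro ideal_prod_subsetI saturation_ideal[OF T J(2)])
    from ideal_prod_saturation[OF T J(2) Js this l(2)]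
    have "ideal_power R Q (2 * Suc l)
        \<subseteq> saturation R (carrier R - Q) (ideal_list_prod R (J # Js))"
      using ideal_prod_assoc[OF Q.is_ideal Q.is_ideal ideal_power_ideal[OF Q.is_ideal, of "2 * l"]]
      by simp
    moreover have "ideal_list_prod R (J # Js) \<subseteq> ideal_power R Q (Suc l)"
      using ideal_prod_mono[OF True l(1)] by simp
    ultimately show ?thesis by blast
  next
    case False
    then obtain u where u: "u \<in> J" "u \<in> carrier R - Q" using ideal.Icarr[OF J(2)] by blast
    have "ideal_list_prod R Js \<subseteq> saturation R (carrier R - Q) (ideal_list_prod R (J # Js))"
    proof
      fix z assume z: "z \<in> ideal_list_prod R Js"
      then have "u \<otimes> z \<in> ideal_list_prod R (J # Js)" using u by (auto intro: ideal_prod.prod)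
      then show "z \<in> saturation R (carrier R - Q) (ideal_list_prod R (J # Js))"
        using u(2) ideal.Icarr[OF Js z] unfolding saturation_def by blast
    qed
    from saturation_saturation[OF T this] l(2)
    have "ideal_power R Q (2 * l) \<subseteq> saturation R (carrier R - Q) (ideal_list_prod R (J # Js))"
      by blast
    moreover have "ideal_list_prod R (J # Js) \<subseteq> ideal_power R Q l"
      using ideal_prod_inter[OF J(2) Js] l(1) by auto
    ultimately show ?thesis by blast
  qed
qed

section \<open>Powers of primes in a TAF-ring\<close>

lemma TAF_ring_factors:
  assumes R: "TAF_ring R" and I: "ideal I R" and ne: "I \<noteq> carrier R"
  obtains Js where "\<And>J. J \<in> set Js \<Longrightarrow> TA_ideal R J" "\<And>J. J \<in> set Js \<Longrightarrow> ideal J R"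
    "\<And>J. J \<in> set Js \<Longrightarrow> I \<subseteq> J" "I = ideal_list_prod R Js"
proof -
  obtain Js where Js: "TA_factorization R I Js" using assms by (auto simp: TAF_ring_def)
  then have 1: "\<And>J. J \<in> set Js \<Longrightarrow> TA_ideal R J" and 2: "I = ideal_list_prod R Js"
    by (auto simp: TA_factorization_def)
  then have 3: "\<And>J. J \<in> set Js \<Longrightarrow> ideal J R" using TA_ideal_ideal by blast
  then have "I \<subseteq> J" if "J \<in> set Js" for J
    unfolding 2 using that by (intro ideal_list_prod_subset) auto
  then show ?thesis using that 1 2 3 by blast
qed

lemma subset_prime_proper:
  assumes "I \<subseteq> P" "primeideal P R"
  shows "I \<noteq> carrier R"
  using assms primeideal.I_notcarr[of P R] ideal_subset_carrier[of P] primeideal.axioms(1)[of P R]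
  by blast

text \<open>Every factor of \<open>K\<close> contains \<open>K\<close>, so \<open>Q\<close> is
  minimal over each factor that it contains, as the bounds for products require.\<close>

lemma TAF_ring_power_bounds:
  assumes R: "TAF_ring R" and K: "ideal K R" and Q: "min_prime_over R Q K"
  obtains l where "K \<subseteq> ideal_power R Q l"
    "ideal_power R Q (2 * l) \<subseteq> saturation R (carrier R - Q) K"
proof -
  note pr = min_prime_over_prime[OF Q] and sub = min_prime_over_subset[OF Q]
  obtain Js where Js: "\<And>J. J \<in> set Js \<Longrightarrow> TA_ideal R J" "\<And>J. J \<in> set Js \<Longrightarrow> K \<subseteq> J"
    "K = ideal_list_prod R Js"
    using TAF_ring_factors[OF R K subset_prime_proper[OF sub pr]] by metis
  have "\<exists>l. ideal_list_prod R Js \<subseteq> ideal_power R Q l \<and>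
      ideal_power R Q (2 * l) \<subseteq> saturation R (carrier R - Q) (ideal_list_prod R Js)"
    by (rule ideal_list_prod_power_bounds[OF pr Js(1)])
      (auto intro: min_prime_over_mono[OF Q] dest: Js(2))
  then show ?thesis using that Js(3) by blast
qed

lemma prime_subset_ideal_power:
  assumes R: "TAF_ring R" and P: "primeideal P R" and x: "x \<in> carrier R" "x \<notin> P"
    and Q: "min_prime_over R Q (adjoin R P x)"
  shows "P \<subseteq> ideal_power R Q k"
proof (cases "k = 0")
  case True
  then show ?thesis using ideal_subset_carrier[OF primeideal.axioms(1)[OF P]] by simp
next
  case False
  interpret P: primeideal P R by (rule P)
  interpret Q: primeideal Q R by (rule min_prime_over_prime[OF Q])
  have xQ: "x \<in> Q" and PQ: "P \<subseteq> Q"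
    using min_prime_over_subset[OF Q] mem_adjoin[OF P.is_ideal x(1)]
      subset_adjoin[OF ideal_subset_carrier[OF P.is_ideal] x(1)] by auto
  \<comment> \<open>The exponent \<open>2 * k\<close> is matched to the \<open>2 * l\<close> of the
    lower bound, so that comparing powers of \<open>x\<close> forces
    \<open>k \<le> l\<close>.\<close>
  let ?K = "adjoin R P (x [^] (2 * k))"
  have K: "ideal ?K R" using adjoin_ideal[OF P.is_ideal] x by simp
  have "min_prime_over R Q ?K"
    using min_prime_over_adjoin_pow[OF Q P.is_ideal x(1)] False by simp
  from TAF_ring_power_bounds[OF R K this] obtain l where
    l: "?K \<subseteq> ideal_power R Q l" "ideal_power R Q (2 * l) \<subseteq> saturation R (carrier R - Q) ?K" by blast
  have "k \<le> l"
  proof (rule ccontr)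
    assume "\<not> k \<le> l"
    \<comment> \<open>Since \<open>d\<close> is positive, \<open>r x^d\<close> lies in
      \<open>Q\<close>. But \<open>s - r x^d\<close> times a power of \<open>x\<close> lies in
      \<open>P\<close>, so \<open>s - r x^d\<close> is in \<open>P\<close>, and \<open>s\<close>
      would fall into \<open>Q\<close>.\<close>
    then obtain d where d: "2 * k = 2 * l + d" "d \<noteq> 0"
      by (metis add_diff_inverse_nat diff_is_0_eq mult_le_cancel1 not_le zero_less_numeral less_imp_le)
    have "x [^] (2 * l) \<in> saturation R (carrier R - Q) ?K"
      using l(2) nat_pow_mem_ideal_power[OF Q.is_ideal xQ] by blast
    then obtain s p r where s: "s \<in> carrier R" "s \<notin> Q" "p \<in> P" "r \<in> carrier R"
      "s \<otimes> x [^] (2 * l) = p \<oplus> r \<otimes> x [^] (2 * k)"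
      by (auto simp: saturation_def adjoin_def)
    let ?X = "x [^] (2 * l)" and ?D = "r \<otimes> x [^] d"
    have c: "?X \<in> carrier R" "?D \<in> carrier R" "p \<in> carrier R" using x s by auto
    have "r \<otimes> x [^] (2 * k) = ?D \<otimes> ?X"
      using x s by (simp add: d(1) nat_pow_mult[symmetric] m_ac)
    then have "(s \<ominus> ?D) \<otimes> ?X = p"
      using s c by (simp add: minus_eq l_distr l_minus a_assoc r_neg)
    then have "s \<ominus> ?D \<in> P"
      using P.I_prime[of "s \<ominus> ?D" ?X] P.pow_mem_iff[OF x(1)] x(2) s c by auto
    then have "s \<oplus> \<ominus> ?D \<in> Q" using PQ by (auto simp: minus_eq)
    moreover have "?D \<in> Q"
      using ideal_mult_carrier[OF Q.is_ideal _ s(4)] Q.pow_mem_iff[OF x(1)] xQ d(2) by auto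
    then have "\<ominus> ?D \<in> Q" by simp
    ultimately have "s \<in> Q" using Q.l_cancel_closed s(1) by blast
    then show False using s by blast
  qed
  then show ?thesis
    using l(1) subset_adjoin[OF ideal_subset_carrier[OF P.is_ideal], of "x [^] (2 * k)"] x
      ideal_power_antimono[OF Q.is_ideal] by fastforce
qed

section \<open>Nakayama-type cancellation\<close>

text \<open>The elementary core of Nakayama's lemma for one generator:
  \<open>s y = r x y + w\<close> becomes \<open>(s - r x) y = w\<close>, and the new coefficient is
  still invertible locally at \<open>Q\<close>.\<close>

lemma minus_mult_mem_compl_prime:
  assumes Q: "primeideal Q R" and s: "s \<in> carrier R - Q" and x: "x \<in> Q" and r: "r \<in> carrier R"
  shows "s \<ominus> r \<otimes> x \<in> carrier R - Q"
proof -
  interpret Q: primeideal Q R by (rule Q)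
  have m: "\<ominus> (r \<otimes> x) \<in> Q" using ideal_mult_carrier[OF Q.is_ideal x r] by simp
  have "s \<oplus> \<ominus> (r \<otimes> x) \<notin> Q" using Q.l_cancel_closed[OF _ m] s by blast
  then show ?thesis using s r Q.Icarr[OF x] by (simp add: minus_eq)
qed

lemma scaled_sum_ideal:
  assumes x: "x \<in> carrier R" and K: "ideal K R" and I: "ideal I R"
  shows "ideal (scaled_sum R x K I) R"
proof (rule idealI_cring)
  note c = x ideal.Icarr[OF K] ideal.Icarr[OF I]
  show "scaled_sum R x K I \<subseteq> carrier R" using c by (auto simp: scaled_sum_def)
  have "\<zero> = x \<otimes> \<zero> \<oplus> \<zero>" using x by simp
  then show "\<zero> \<in> scaled_sum R x K I"
    using ideal_zero_mem[OF I] ideal_zero_mem[OF K] unfolding scaled_sum_def by blast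
  show "a \<oplus> b \<in> scaled_sum R x K I" if a: "a \<in> scaled_sum R x K I" and b: "b \<in> scaled_sum R x K I"
    for a b
  proof -
    from a b obtain k i l j where e: "a = x \<otimes> k \<oplus> i" "b = x \<otimes> l \<oplus> j"
      "k \<in> K" "l \<in> K" "i \<in> I" "j \<in> I" by (auto simp: scaled_sum_def)
    have "a \<oplus> b = x \<otimes> (k \<oplus> l) \<oplus> (i \<oplus> j)" using e c by (simp add: r_distr a_ac)
    then show ?thesis
      using e ideal_add_mem[OF I] ideal_add_mem[OF K] unfolding scaled_sum_def by blast
  qed
  show "q \<otimes> a \<in> scaled_sum R x K I" if a: "a \<in> scaled_sum R x K I" and q: "q \<in> carrier R" for a q
  proof -
    from a obtain k i where e: "a = x \<otimes> k \<oplus> i" "k \<in> K" "i \<in> I" by (auto simp: scaled_sum_def)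
    have "q \<otimes> a = x \<otimes> (q \<otimes> k) \<oplus> q \<otimes> i" using e c q by (simp add: r_distr m_ac)
    then show ?thesis
      using e q ideal_mult_carrier[OF I] ideal_mult_carrier[OF K] unfolding scaled_sum_def by blast
  qed
qed

text \<open>Multiplying a local relation \<open>j = x l + i\<close> by an element of the other
  factor preserves its shape, since \<open>I\<close> absorbs the last term. The disjunction lets the
  relation start from either factor, as the induction over a list demands.\<close>

lemma ideal_prod_scaled_sum:
  assumes T: "submonoid T R" and x: "x \<in> carrier R"
    and J: "ideal J R" and K: "ideal K R" and I: "ideal I R"
    and sub: "J \<subseteq> saturation R T (scaled_sum R x J I) \<or> K \<subseteq> saturation R T (scaled_sum R x K I)"
  shows "J \<cdot> K \<subseteq> saturation R T (scaled_sum R x (J \<cdot> K) I)"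
proof (rule ideal_prod_subsetI)
  interpret T: submonoid T R by (rule T)
  show "ideal (saturation R T (scaled_sum R x (J \<cdot> K) I)) R"
    by (intro saturation_ideal scaled_sum_ideal ideal_prod_is_ideal T x J K I)
  fix j k assume j: "j \<in> J" and k: "k \<in> K"
  note c = x ideal.Icarr[OF J j] ideal.Icarr[OF K k]
  from sub consider (J) "j \<in> saturation R T (scaled_sum R x J I)"
    | (K) "k \<in> saturation R T (scaled_sum R x K I)" using j k by blast
  then have "\<exists>s\<in>T. s \<otimes> (j \<otimes> k) \<in> scaled_sum R x (J \<cdot> K) I"
  proof cases
    case J
    then obtain s l i where s: "s \<in> T" "s \<otimes> j = x \<otimes> l \<oplus> i" "l \<in> J" "i \<in> I"
      by (auto simp: saturation_def scaled_sum_def)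
    note c = c T.subset[THEN subsetD, OF s(1)] ideal.Icarr[OF \<open>ideal J R\<close> s(3)] ideal.Icarr[OF I s(4)]
    have "s \<otimes> (j \<otimes> k) = (s \<otimes> j) \<otimes> k" using c by (simp add: m_ac)
    also have "\<dots> = x \<otimes> (l \<otimes> k) \<oplus> k \<otimes> i" unfolding s(2) using c by (simp add: l_distr r_distr m_ac)
    also have "\<dots> \<in> scaled_sum R x (J \<cdot> K) I"
      using ideal_prod.prod[OF s(3) k, of R] ideal_mult_carrier[OF I s(4) c(3)]
      unfolding scaled_sum_def by blast
    finally show ?thesis using s(1) by blast
  next
    case K
    then obtain s l i where s: "s \<in> T" "s \<otimes> k = x \<otimes> l \<oplus> i" "l \<in> K" "i \<in> I"
      by (auto simp: saturation_def scaled_sum_def)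
    note c = c T.subset[THEN subsetD, OF s(1)] ideal.Icarr[OF \<open>ideal K R\<close> s(3)] ideal.Icarr[OF I s(4)]
    have "s \<otimes> (j \<otimes> k) = j \<otimes> (s \<otimes> k)" using c by (simp add: m_ac)
    also have "\<dots> = x \<otimes> (j \<otimes> l) \<oplus> j \<otimes> i" unfolding s(2) using c by (simp add: r_distr m_ac)
    also have "\<dots> \<in> scaled_sum R x (J \<cdot> K) I"
      using ideal_prod.prod[OF j s(3), of R] ideal_mult_carrier[OF I s(4) c(2)]
      unfolding scaled_sum_def by blast
    finally show ?thesis using s(1) by blast
  qed
  then show "j \<otimes> k \<in> saturation R T (scaled_sum R x (J \<cdot> K) I)"
    using c by (auto simp: saturation_def)
qed

lemma ideal_list_prod_scaled_sum:
  assumes T: "submonoid T R" and x: "x \<in> carrier R" and I: "ideal I R"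
    and J: "J \<subseteq> saturation R T (scaled_sum R x J I)"
  shows "\<forall>K\<in>set Js. ideal K R \<Longrightarrow> J \<in> set Js \<Longrightarrow>
    ideal_list_prod R Js \<subseteq> saturation R T (scaled_sum R x (ideal_list_prod R Js) I)"
proof (induction Js)
  case (Cons K Js)
  have "K \<cdot> ideal_list_prod R Js \<subseteq> saturation R T (scaled_sum R x (K \<cdot> ideal_list_prod R Js) I)"
  proof (rule ideal_prod_scaled_sum[OF T x _ _ I])
    show "ideal (ideal_list_prod R Js) R" using Cons.prems by (intro ideal_list_prod_ideal) auto
  qed (use Cons J in auto)
  then show ?case by simp
qed simp

lemma TAF_ring_mem_saturation:
  assumes R: "TAF_ring R" and I: "ideal I R" and x: "x \<in> carrier R" and y: "y \<in> carrier R"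
    and Q: "min_prime_over R Q (adjoin R (adjoin R I y) x)"
    and P: "primeideal P R" "adjoin R I y \<subseteq> P" "P \<subset> Q"
  shows "y \<in> saturation R (carrier R - Q) I"
proof -
  interpret P: primeideal P R by (rule P)
  interpret Q: primeideal Q R by (rule min_prime_over_prime[OF Q])
  let ?T = "carrier R - Q"
  have T: "submonoid ?T R" by (rule submonoid_compl_prime[OF Q.primeideal])
  have Iy: "ideal (adjoin R I y) R" by (rule adjoin_ideal[OF I y])
  have IP: "I \<subseteq> P" "y \<in> P"
    using P(2) mem_adjoin[OF I y] subset_adjoin[OF ideal_subset_carrier[OF I] y] by auto
  have xQ: "x \<in> Q" using min_prime_over_subset[OF Q] mem_adjoin[OF Iy x] by blast
  \<comment> \<open>Otherwise \<open>P\<close> would contain the whole ideal over which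
    \<open>Q\<close> is minimal.\<close>
  have xP: "x \<notin> P"
    using min_prime_over_minimal[OF Q P.primeideal adjoin_subset[OF P.is_ideal P(2)]] P(3) by blast
  have x2: "x [^] (2::nat) \<in> carrier R" and y2: "y [^] (2::nat) \<in> carrier R" using x y by auto
  have Ix: "ideal (adjoin R I (x [^] (2::nat))) R" by (rule adjoin_ideal[OF I x2])
  let ?K = "adjoin R (adjoin R I (x [^] (2::nat))) (y [^] (2::nat))"
  let ?S = "saturation R ?T (adjoin R I (x [^] (2::nat)))"
  have K: "ideal ?K R" by (rule adjoin_ideal[OF Ix y2])
  have S: "ideal ?S R" by (rule saturation_ideal[OF T Ix])
  \<comment> \<open>The two generators are replaced by their squares one after the other;
    \<open>adjoin_commute\<close> brings the next one to the outer position.\<close>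
  have "min_prime_over R Q (adjoin R (adjoin R I y) (x [^] (2::nat)))"
    by (rule min_prime_over_adjoin_pow[OF Q Iy x]) simp
  then have "min_prime_over R Q (adjoin R (adjoin R I (x [^] (2::nat))) y)"
    by (simp only: adjoin_commute[OF I y x2])
  then have minK: "min_prime_over R Q ?K"
    by (rule min_prime_over_adjoin_pow[OF _ Ix y]) simp
  obtain l where "ideal_power R Q (2 * l) \<subseteq> saturation R ?T ?K"
    using TAF_ring_power_bounds[OF R K minK] by blast
  \<comment> \<open>\<open>Q\<close> is also minimal over \<open>P + (x)\<close>, so
    \<open>P\<close> lies in every power of \<open>Q\<close>, in particular in the one that is
    locally inside \<open>?K\<close>.\<close>
  moreover have "P \<subseteq> ideal_power R Q (2 * l)"
  proof (rule prime_subset_ideal_power[OF R P.primeideal x xP])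
    have "adjoin R (adjoin R I y) x \<subseteq> adjoin R P x" using P(2) unfolding adjoin_def[of R _ x] by blast
    moreover have "adjoin R P x \<subseteq> Q" using adjoin_subset[OF Q.is_ideal] P(3) xQ by blast
    ultimately show "min_prime_over R Q (adjoin R P x)" by (rule min_prime_over_mono[OF Q])
  qed
  ultimately have PK: "P \<subseteq> saturation R ?T ?K" by blast
  \<comment> \<open>The square of \<open>y\<close> is absorbed: \<open>s y = w + r y^2\<close>
    becomes \<open>(s - r y) y = w\<close>, where \<open>s - r y\<close> avoids \<open>Q\<close>
    because \<open>y\<close> is in \<open>Q\<close>.\<close>
  have yS: "y \<in> ?S"
  proof -
    obtain s w r where s: "s \<in> ?T" "w \<in> adjoin R I (x [^] (2::nat))" "r \<in> carrier R"
      "s \<otimes> y = w \<oplus> r \<otimes> y [^] (2::nat)"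
      using PK IP(2) by (auto simp: saturation_def adjoin_def[of R "adjoin R I (x [^] (2::nat))"])
    have wc: "w \<in> carrier R" using ideal.Icarr[OF Ix s(2)] .
    have "r \<otimes> y [^] (2::nat) = (r \<otimes> y) \<otimes> y" using y s(3) by (simp add: numeral_2_eq_2 m_assoc)
    then have "(s \<ominus> r \<otimes> y) \<otimes> y = w"
      using s y wc by (simp add: minus_eq l_distr l_minus a_assoc r_neg)
    then have "(s \<ominus> r \<otimes> y) \<otimes> y \<in> adjoin R I (x [^] (2::nat))" using s by simp
    moreover have "s \<ominus> r \<otimes> y \<in> ?T"
      using minus_mult_mem_compl_prime[OF Q.primeideal s(1) _ s(3)] IP P(3) by blast
    ultimately show ?thesis using y unfolding saturation_def by blast
  qed
  \<comment> \<open>The generator \<open>y^2\<close> is therefore redundant locally, and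
    \<open>P\<close> lies in \<open>I + (x^2)\<close> locally.\<close>
  have "?K \<subseteq> ?S"
  proof (rule adjoin_subset[OF S subset_saturation[OF T Ix]])
    show "y [^] (2::nat) \<in> ?S"
      using ideal_mult_carrier[OF S yS y] y by (simp add: numeral_2_eq_2)
  qed
  from saturation_saturation[OF T this] PK have PS: "P \<subseteq> ?S" by blast
  obtain Js where Js: "\<And>J. J \<in> set Js \<Longrightarrow> TA_ideal R J" "\<And>J. J \<in> set Js \<Longrightarrow> ideal J R"
    "\<And>J. J \<in> set Js \<Longrightarrow> adjoin R I y \<subseteq> J" "adjoin R I y = ideal_list_prod R Js"
    using TAF_ring_factors[OF R Iy subset_prime_proper[OF P(2) P.primeideal]] by metis
  obtain J where J: "J \<in> set Js" "J \<subseteq> P"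
    using P.ideal_list_prod_subset_prime[of Js] Js P(2) by blast
  have IJ: "I \<subseteq> J"
    using Js(3)[OF J(1)] subset_adjoin[OF ideal_subset_carrier[OF I] y] by blast
  \<comment> \<open>Write \<open>s j = i + t x^2\<close>. Since \<open>i\<close> is in
    \<open>J\<close>, so is \<open>x x t\<close>; the TA property gives \<open>x t\<close> in
    \<open>J\<close>, because \<open>x^2\<close> avoids \<open>P\<close>.\<close>
  have "J \<subseteq> saturation R ?T (scaled_sum R x J I)"
  proof
    fix j assume j: "j \<in> J"
    then have jc: "j \<in> carrier R" using ideal.Icarr[OF Js(2)[OF J(1)]] by blast
    obtain s i t where s: "s \<in> ?T" "i \<in> I" "t \<in> carrier R" "s \<otimes> j = i \<oplus> t \<otimes> x [^] (2::nat)"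
      using j J(2) PS by (auto simp: saturation_def adjoin_def)
    have c: "i \<in> carrier R" "s \<in> carrier R" using s ideal.Icarr[OF I] by auto
    have tx: "t \<otimes> x [^] (2::nat) = x \<otimes> x \<otimes> t" using x s by (simp add: numeral_2_eq_2 m_ac)
    have "s \<otimes> j \<in> J" using ideal_mult_carrier[OF Js(2)[OF J(1)] j c(2)] .
    then have "x \<otimes> x \<otimes> t \<oplus> i \<in> J" using s(3) c x by (simp add: s(4) tx a_comm)
    then have "x \<otimes> x \<otimes> t \<in> J"
      using ideal.l_cancel_closed[OF Js(2)[OF J(1)]] IJ s x by auto
    moreover have "x \<otimes> x \<notin> J" using J(2) P.I_prime[OF x x] xP by blast
    ultimately have "x \<otimes> t \<in> J" using TA_idealD[OF Js(1)[OF J(1)] x x s(3)] by blast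
    moreover have "s \<otimes> j = x \<otimes> (x \<otimes> t) \<oplus> i"
      using s(3) c x by (simp add: s(4) tx a_comm m_assoc)
    ultimately show "j \<in> saturation R ?T (scaled_sum R x J I)"
      using s(1,2) jc unfolding saturation_def scaled_sum_def by blast
  qed
  \<comment> \<open>The product of all factors is \<open>I + (y)\<close> itself, which thus inherits
    the relation of its single factor \<open>J\<close>.\<close>
  from ideal_list_prod_scaled_sum[OF T x I this, of Js] Js(2) J(1)
  have "adjoin R I y \<subseteq> saturation R ?T (scaled_sum R x (adjoin R I y) I)"
    by (simp add: Js(4)[symmetric])
  then have "y \<in> saturation R ?T (scaled_sum R x (adjoin R I y) I)"
    using mem_adjoin[OF I y] by blast
  then obtain s k i where s: "s \<in> ?T" "k \<in> adjoin R I y" "i \<in> I" "s \<otimes> y = x \<otimes> k \<oplus> i"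
    by (auto simp: saturation_def scaled_sum_def)
  obtain j r where j: "j \<in> I" "r \<in> carrier R" "k = j \<oplus> r \<otimes> y" using s(2) by (auto simp: adjoin_def)
  note c = ideal.Icarr[OF I j(1)] ideal.Icarr[OF I s(3)] j(2) x y
  \<comment> \<open>Substituting \<open>k = j + r y\<close> leaves \<open>y\<close> multiplied by
    \<open>r x\<close> on the right, ready for cancellation.\<close>
  have "s \<otimes> y = (x \<otimes> j \<oplus> i) \<oplus> (r \<otimes> x) \<otimes> y"
    using c by (simp add: s(4) j(3) r_distr m_ac a_ac)
  then have "(s \<ominus> r \<otimes> x) \<otimes> y = x \<otimes> j \<oplus> i"
    using c s(1) by (simp add: minus_eq l_distr l_minus a_assoc r_neg)
  moreover have "x \<otimes> j \<oplus> i \<in> I"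
    by (rule ideal_add_mem[OF I ideal_mult_carrier[OF I j(1) x] s(3)])
  ultimately have "(s \<ominus> r \<otimes> x) \<otimes> y \<in> I" by simp
  then show ?thesis
    using minus_mult_mem_compl_prime[OF Q.primeideal s(1) xQ j(2)] y unfolding saturation_def by blast
qed

section \<open>Chains of primes in a TAF-ring\<close>

text \<open>Prime avoidance yields \<open>x\<close> in \<open>M\<close> outside the finitely many
  minimal primes of \<open>I + (y)\<close>. A minimal prime \<open>Q\<close> of
  \<open>I + (y, x)\<close> inside \<open>M\<close> then lies strictly above some minimal prime
  \<open>P'\<close> of \<open>I + (y)\<close>, with \<open>x\<close> as the separating
  element.\<close>

lemma TAF_ring_obtain_intermediate:
  assumes R: "TAF_ring R" and I: "ideal I R" and y: "y \<in> carrier R"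
    and P: "primeideal P R" "adjoin R I y \<subseteq> P" and M: "primeideal M R" "P \<subset> M"
  obtains Q P' where "primeideal Q R" "Q \<subseteq> M" "primeideal P' R" "adjoin R I y \<subseteq> P'" "P' \<subset> Q"
    "y \<in> saturation R (carrier R - Q) I"
proof -
  have Iy: "ideal (adjoin R I y) R" by (rule adjoin_ideal[OF I y])
  have IyM: "adjoin R I y \<subseteq> M" using P M by blast
  have Mi: "ideal M R" by (rule primeideal.axioms(1)[OF M(1)])
  obtain Js where Js: "\<And>J. J \<in> set Js \<Longrightarrow> TA_ideal R J" "adjoin R I y = ideal_list_prod R Js"
    using TAF_ring_factors[OF R Iy subset_prime_proper[OF P(2,1)]] by metis
  define F where "F = {N. min_prime_over R N (adjoin R I y)}"
  have "\<exists>x\<in>M. \<forall>N\<in>F. x \<notin> N"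
  proof (rule prime_avoidance[OF Mi])
    show "finite F"
      unfolding F_def Js(2) using Js(1) by (intro finite_min_primes_over_ideal_list_prod) blast
  next
    fix N assume "N \<in> F"
    then have N: "min_prime_over R N (adjoin R I y)" by (simp add: F_def)
    \<comment> \<open>A minimal prime containing \<open>M\<close> would contain \<open>P\<close>,
      hence equal \<open>P\<close>, which is strictly smaller than \<open>M\<close>.\<close>
    have "\<not> M \<subseteq> N"
    proof
      assume "M \<subseteq> N"
      then have "P = N" using min_prime_over_minimal[OF N P] M(2) by blast
      then show False using \<open>M \<subseteq> N\<close> M(2) by blast
    qed
    then show "primeideal N R \<and> \<not> M \<subseteq> N" using min_prime_over_prime[OF N] by blast
  next
    fix N N' assume "N \<in> F" "N' \<in> F" "N \<subseteq> N'"
    then show "N = N'"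
      unfolding F_def using min_prime_over_minimal min_prime_over_prime min_prime_over_subset by blast
  qed
  then obtain x where x: "x \<in> M" "\<And>N. min_prime_over R N (adjoin R I y) \<Longrightarrow> x \<notin> N"
    by (auto simp: F_def)
  have xc: "x \<in> carrier R" using ideal.Icarr[OF Mi x(1)] .
  obtain Q where Q: "min_prime_over R Q (adjoin R (adjoin R I y) x)" "Q \<subseteq> M"
    using exists_min_prime_over_below[OF adjoin_ideal[OF Iy xc] M(1) adjoin_subset[OF Mi IyM x(1)]] by blast
  note pQ = min_prime_over_prime[OF Q(1)]
  have sub: "adjoin R I y \<subseteq> Q" "x \<in> Q"
    using min_prime_over_subset[OF Q(1)] subset_adjoin[OF ideal_subset_carrier[OF Iy] xc]
      mem_adjoin[OF Iy xc] by auto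
  obtain P' where P': "min_prime_over R P' (adjoin R I y)" "P' \<subseteq> Q"
    using exists_min_prime_over_below[OF Iy pQ sub(1)] by blast
  have lt: "P' \<subset> Q" using P' x(2)[OF P'(1)] sub(2) by blast
  note pP' = min_prime_over_prime[OF P'(1)] min_prime_over_subset[OF P'(1)]
  have "y \<in> saturation R (carrier R - Q) I"
    by (rule TAF_ring_mem_saturation[OF R I xc y Q(1) pP' lt])
  then show ?thesis using that pQ Q(2) pP' lt by blast
qed

text \<open>Take \<open>I = P0\<close> and \<open>y\<close> in \<open>P1 - P0\<close>. The
  multiplier \<open>s\<close> with \<open>s \<otimes> y\<close> in \<open>P0\<close> would lie in
  \<open>P0\<close>, hence in \<open>Q\<close>, which it avoids.\<close>

lemma TAF_ring_no_prime_chain: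
  assumes R: "TAF_ring R" and P: "primeideal P0 R" "primeideal P1 R" "primeideal P2 R"
    and lt: "P0 \<subset> P1" "P1 \<subset> P2"
  shows False
proof -
  interpret P0: primeideal P0 R by (rule P)
  interpret P1: primeideal P1 R by (rule P)
  obtain y where y: "y \<in> P1" "y \<notin> P0" using lt by blast
  have yc: "y \<in> carrier R" using P1.Icarr[OF y(1)] .
  have sub: "adjoin R P0 y \<subseteq> P1" using adjoin_subset[OF P1.is_ideal] lt y by blast
  obtain Q P' where Q: "primeideal Q R" "Q \<subseteq> P2" "primeideal P' R" "adjoin R P0 y \<subseteq> P'" "P' \<subset> Q"
    "y \<in> saturation R (carrier R - Q) P0"
    by (rule TAF_ring_obtain_intermediate[OF R P0.is_ideal yc P(2) sub P(3) lt(2)])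
  then obtain s where s: "s \<in> carrier R" "s \<notin> Q" "s \<otimes> y \<in> P0" by (auto simp: saturation_def)
  then have "s \<in> P0" using P0.I_prime[OF s(1) yc] y by blast
  then show False
    using s Q(4,5) subset_adjoin[OF ideal_subset_carrier[OF P0.is_ideal] yc] by blast
qed

text \<open>Take \<open>I\<close> to be the zero ideal. The prime \<open>Q\<close> obtained below
  \<open>M\<close> already has a prime strictly below it, so the absence of longer chains forces
  \<open>Q = M\<close>.\<close>

lemma TAF_ring_nonmaximal_prime_annihilated:
  assumes R: "TAF_ring R" and P: "primeideal P R" and M: "primeideal M R" and lt: "P \<subset> M"
    and y: "y \<in> P"
  obtains s where "s \<in> carrier R - M" "s \<otimes> y = \<zero>"
proof -
  interpret P: primeideal P R by (rule P)
  have yc: "y \<in> carrier R" using P.Icarr[OF y] .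
  have sub: "adjoin R {\<zero>} y \<subseteq> P" 
    by (rule adjoin_subset[OF P.is_ideal _ y]) (use ideal_zero_mem[OF P.is_ideal] in simp)
  obtain Q P' where Q: "primeideal Q R" "Q \<subseteq> M" "primeideal P' R" "adjoin R {\<zero>} y \<subseteq> P'"
    "P' \<subset> Q" "y \<in> saturation R (carrier R - Q) {\<zero>}"
    by (rule TAF_ring_obtain_intermediate[OF R zeroideal yc P sub M lt])
  then have "Q = M" using TAF_ring_no_prime_chain[OF R Q(3,1) M Q(5)] by blast
  then show ?thesis using Q(6) that by (auto simp: saturation_def)
qed

section \<open>Bounds for the Krull dimension\<close>

lemma krull_dim_le_1:
  assumes "\<And>P0 P1 P2. \<lbrakk>primeideal P0 R; primeideal P1 R; primeideal P2 R; P0 \<subset> P1; P1 \<subset> P2\<rbrakk> \<Longrightarrow> False"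
  shows "krull_dim R \<le> 1"
  unfolding krull_dim_def
proof (rule SUP_least, clarify)
  fix n P assume P: "prime_chain R n P"
  have "n \<le> 1"
  proof (rule ccontr)
    assume "\<not> n \<le> 1"
    then have "primeideal (P 0) R" "primeideal (P 1) R" "primeideal (P 2) R"
      "P 0 \<subset> P (Suc 0)" "P 1 \<subset> P (Suc 1)"
      using P unfolding prime_chain_def by (auto simp del: psubset_eq)
    then show False using assms[of "P 0" "P 1" "P 2"] by (simp add: numeral_2_eq_2)
  qed
  then show "ereal (real n) \<le> 1" by (simp add: one_ereal_def)
qed

lemma krull_dim_ge_1:
  assumes "primeideal P R" "primeideal Q R" "P \<subset> Q"
  shows "1 \<le> krull_dim R"
proof -
  have "prime_chain R 1 (\<lambda>i. if i = 0 then P else Q)" using assms by (auto simp: prime_chain_def)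
  then have "ereal (real 1) \<le> krull_dim R" unfolding krull_dim_def by (intro SUP_upper) blast
  then show ?thesis by (simp add: one_ereal_def)
qed

text \<open>The given prime \<open>M\<close> excludes the value minus infinity, which is the
  supremum when there are no primes at all.\<close>

lemma krull_dim_eq_0:
  assumes "primeideal M R" "\<And>P Q. \<lbrakk>primeideal P R; primeideal Q R; P \<subset> Q\<rbrakk> \<Longrightarrow> False"
  shows "krull_dim R = 0"
proof (rule antisym)
  have "prime_chain R 0 (\<lambda>i. M)" using assms by (auto simp: prime_chain_def)
  then have "ereal (real 0) \<le> krull_dim R" unfolding krull_dim_def by (intro SUP_upper) blast
  then show "0 \<le> krull_dim R" by (simp add: zero_ereal_def)
  show "krull_dim R \<le> 0"
    unfolding krull_dim_def
  proof (rule SUP_least, clarify)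
    fix n P assume P: "prime_chain R n P"
    have "n = 0"
    proof (rule ccontr)
      assume "n \<noteq> 0"
      then have "primeideal (P 0) R" "primeideal (P (Suc 0)) R" "P 0 \<subset> P (Suc 0)"
        using P unfolding prime_chain_def by auto
      then show False using assms(2) by blast
    qed
    then show "ereal (real n) \<le> 0" by simp
  qed
qed

lemma exists_primeideal:
  assumes "\<one> \<noteq> \<zero>"
  shows "\<exists>P. primeideal P R"
proof -
  have "submonoid {\<one>} R" by unfold_locales auto
  then show ?thesis
    using exists_min_prime_over[OF zeroideal, of "{\<one>}"] assms min_prime_over_prime by blast
qed

section \<open>Primes of a localization\<close>

definition contraction :: "'a set \<Rightarrow> ('a \<times> 'a) set set \<Rightarrow> 'a set" where
  "contraction S P = {a \<in> carrier R. fraction R S a \<one> \<in> P}"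

context
  fixes S
  assumes S: "submonoid S R"
begin

lemma fraction_mem_carrier:
  "a \<in> carrier R \<Longrightarrow> s \<in> S \<Longrightarrow> fraction R S a s \<in> carrier (localization R S)"
  by (auto simp: carrier_localization[OF S])

lemma fraction_eq_zero_iff:
  assumes "a \<in> carrier R" "s \<in> S"
  shows "fraction R S a s = \<zero>\<^bsub>localization R S\<^esub> \<longleftrightarrow> (\<exists>u\<in>S. u \<otimes> a = \<zero>)"
proof -
  have "fraction R S a s = \<zero>\<^bsub>localization R S\<^esub> \<longleftrightarrow> (\<exists>u\<in>S. u \<otimes> (\<one> \<otimes> a) = u \<otimes> (s \<otimes> \<zero>))"
    unfolding localization_zero[OF S] using assms S_one[OF S] by (intro fraction_eq_iff[OF S]) auto
  then show ?thesis using assms S_carr[OF S] by auto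
qed

text \<open>The fractions \<open>a/s\<close> and \<open>a/1\<close> differ by the unit
  \<open>s/1\<close>, so numerators decide membership.\<close>

lemma fraction_mem_prime_iff:
  assumes P: "primeideal P (localization R S)" and a: "a \<in> carrier R" and s: "s \<in> S"
  shows "fraction R S a s \<in> P \<longleftrightarrow> fraction R S a \<one> \<in> P"
proof -
  interpret P: primeideal P "localization R S" by (rule P)
  have c: "s \<in> carrier R" using S_carr[OF S s] .
  have 1: "fraction R S a s = fraction R S \<one> s \<otimes>\<^bsub>localization R S\<^esub> fraction R S a \<one>"
    using a s c S_one[OF S] by (simp add: localization_mult[OF S])
  have "fraction R S a \<one> = fraction R S (s \<otimes> a) (\<one> \<otimes> s)"
    using a s c S_one[OF S] by (subst fraction_eq_iff[OF S]) auto
  also have "\<dots> = fraction R S s \<one> \<otimes>\<^bsub>localization R S\<^esub> fraction R S a s"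
    using a s c S_one[OF S] by (simp only: localization_mult[OF S])
  finally have 2: "fraction R S a \<one> = fraction R S s \<one> \<otimes>\<^bsub>localization R S\<^esub> fraction R S a s" .
  show ?thesis
  proof
    assume "fraction R S a s \<in> P"
    then show "fraction R S a \<one> \<in> P"
      unfolding 2 using c S_one[OF S] by (intro P.I_l_closed fraction_mem_carrier)
  next
    assume "fraction R S a \<one> \<in> P"
    then show "fraction R S a s \<in> P"
      unfolding 1 using s by (intro P.I_l_closed fraction_mem_carrier) auto
  qed
qed

lemma primeideal_contraction:
  assumes P: "primeideal P (localization R S)"
  shows "primeideal (contraction S P) R"
proof -
  let ?L = "localization R S"
  interpret P: primeideal P ?L by (rule P)
  note c = S_one[OF S] fraction_mem_carrier
  have mult: "fraction R S (a \<otimes> b) \<one> = fraction R S a \<one> \<otimes>\<^bsub>?L\<^esub> fraction R S b \<one>"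
    if "a \<in> carrier R" "b \<in> carrier R" for a b
    using that by (simp add: localization_mult[OF S] c)
  have add: "fraction R S (a \<oplus> b) \<one> = fraction R S a \<one> \<oplus>\<^bsub>?L\<^esub> fraction R S b \<one>"
    if "a \<in> carrier R" "b \<in> carrier R" for a b
    using that by (simp add: localization_add[OF S] c)
  have "ideal (contraction S P) R"
  proof (rule idealI_cring)
    show "\<zero> \<in> contraction S P"
      using additive_subgroup.zero_closed[OF P.additive_subgroup_axioms] localization_zero[OF S]
      by (simp add: contraction_def)
    show "a \<oplus> b \<in> contraction S P" if "a \<in> contraction S P" "b \<in> contraction S P" for a b
      using that additive_subgroup.a_closed[OF P.additive_subgroup_axioms]
      by (simp add: contraction_def add)
    show "r \<otimes> a \<in> contraction S P" if "a \<in> contraction S P" "r \<in> carrier R" for a r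
      using that P.I_l_closed c by (simp add: contraction_def mult)
  qed (auto simp: contraction_def)
  then show ?thesis
  proof (rule primeidealI[OF _ cring_axioms])
    have "\<one> \<notin> contraction S P"
      using P.one_imp_carrier P.I_notcarr localization_one[OF S] by (auto simp: contraction_def)
    then show "carrier R \<noteq> contraction S P" by auto
    show "a \<in> contraction S P \<or> b \<in> contraction S P"
      if "a \<in> carrier R" "b \<in> carrier R" "a \<otimes> b \<in> contraction S P" for a b
      using that P.I_prime[of "fraction R S a \<one>" "fraction R S b \<one>"] c
      by (auto simp: contraction_def mult)
  qed
qed

lemma contraction_disjoint:
  assumes P: "primeideal P (localization R S)"
  shows "contraction S P \<inter> S = {}"
proof (rule ccontr)
  let ?L = "localization R S"
  interpret P: primeideal P ?L by (rule P)
  assume "contraction S P \<inter> S \<noteq> {}"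
  then obtain s where s: "s \<in> S" "fraction R S s \<one> \<in> P" "s \<in> carrier R"
    by (auto simp: contraction_def)
  then have "fraction R S s s \<in> P" using fraction_mem_prime_iff[OF P] by blast
  moreover have "fraction R S s s = \<one>\<^bsub>?L\<^esub>"
    unfolding localization_one[OF S] using s S_one[OF S] by (subst fraction_eq_iff[OF S]) auto
  ultimately show False using P.one_imp_carrier P.I_notcarr by auto
qed

text \<open>Carries chains of primes from the localization down to \<open>R\<close>: the numerator
  of a fraction separating \<open>P\<close> from \<open>Q\<close> separates the
  contractions.\<close>

lemma contraction_strict_mono:
  assumes P: "primeideal P (localization R S)" and Q: "primeideal Q (localization R S)"
    and lt: "P \<subset> Q"
  shows "contraction S P \<subset> contraction S Q"
proof -
  obtain z where z: "z \<in> Q" "z \<notin> P" using lt by blast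
  have "z \<in> carrier (localization R S)" using ideal.Icarr[OF primeideal.axioms(1)[OF Q] z(1)] .
  then obtain a s where a: "a \<in> carrier R" "s \<in> S" "z = fraction R S a s"
    by (auto simp: carrier_localization[OF S])
  then have "a \<in> contraction S Q - contraction S P"
    using z fraction_mem_prime_iff[OF P a(1,2)] fraction_mem_prime_iff[OF Q a(1,2)]
    by (auto simp: contraction_def)
  then show ?thesis using lt by (auto simp: contraction_def)
qed

text \<open>The assumptions make \<open>P\<close> the kernel of the map from \<open>R\<close> to the
  localization: \<open>ann\<close> gives one inclusion, disjointness from \<open>S\<close> and
  primality the other. A product of fractions can then be tested for zero on its numerator in
  \<open>P\<close>.\<close>

lemma domain_localizationI:
  assumes P: "primeideal P R" and dis: "P \<inter> S = {}"
    and ann: "\<And>y. y \<in> P \<Longrightarrow> \<exists>s\<in>S. s \<otimes> y = \<zero>"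
  shows "domain (localization R S)"
proof -
  let ?L = "localization R S"
  interpret P: primeideal P R by (rule P)
  interpret L: cring ?L by (rule cring_localization[OF S])
  have zero: "fraction R S a s = \<zero>\<^bsub>?L\<^esub> \<longleftrightarrow> a \<in> P" if a: "a \<in> carrier R" "s \<in> S" for a s
  proof
    assume "fraction R S a s = \<zero>\<^bsub>?L\<^esub>"
    then obtain u where u: "u \<in> S" "u \<otimes> a = \<zero>" using fraction_eq_zero_iff[OF a] by blast
    then have "u \<otimes> a \<in> P" "u \<notin> P" using ideal_zero_mem[OF P.is_ideal] dis by auto
    then show "a \<in> P" using P.I_prime[OF S_carr[OF S u(1)] a(1)] by blast
  qed (use ann fraction_eq_zero_iff[OF a] in blast)
  show ?thesis
  proof (rule domain.intro[OF L.cring_axioms], rule domain_axioms.intro)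
    show "\<one>\<^bsub>?L\<^esub> \<noteq> \<zero>\<^bsub>?L\<^esub>"
      using zero[of \<one> \<one>] S_one[OF S] dis localization_one[OF S] by auto
  next
    fix A B assume "A \<otimes>\<^bsub>?L\<^esub> B = \<zero>\<^bsub>?L\<^esub>" "A \<in> carrier ?L" "B \<in> carrier ?L"
    then obtain a s b t where m: "A = fraction R S a s" "B = fraction R S b t" "a \<in> carrier R"
      "s \<in> S" "b \<in> carrier R" "t \<in> S" "fraction R S (a \<otimes> b) (s \<otimes> t) = \<zero>\<^bsub>?L\<^esub>"
      by (auto simp: carrier_localization[OF S] localization_mult[OF S])
    then have "a \<otimes> b \<in> P" using zero[of "a \<otimes> b" "s \<otimes> t"] S_mult[OF S] by auto
    then show "A = \<zero>\<^bsub>?L\<^esub> \<or> B = \<zero>\<^bsub>?L\<^esub>" using P.I_prime m zero by auto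
  qed
qed

end

end

theorem theorem3p1:
  fixes R :: "('a, 'b) ring_scheme"
  assumes "TAF_ring R"
  shows "(\<forall>M. maximalideal M R \<longrightarrow>
            krull_dim (localization_at R M) = 0 \<or>
            (domain (localization_at R M) \<and> krull_dim (localization_at R M) = 1)) \<and>
         krull_dim R \<le> 1"
proof -
  interpret cring R using assms by (simp add: TAF_ring_def)
  have le1: "krull_dim R \<le> 1"
    by (rule krull_dim_le_1) (rule TAF_ring_no_prime_chain[OF assms])
  have "krull_dim (localization_at R M) = 0 \<or>
      (domain (localization_at R M) \<and> krull_dim (localization_at R M) = 1)"
    if max: "maximalideal M R" for M
  proof -
    let ?S = "carrier R - M" and ?L = "localization_at R M"
    have M: "primeideal M R" by (rule maximalideal_prime[OF max])
    interpret M: primeideal M R by (rule M)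
    have S: "submonoid ?S R" by (rule submonoid_compl_prime[OF M])
    have L: "?L = localization R ?S" by (simp add: localization_at_def)
    interpret L: cring ?L by (rule cring_localization_at[OF M])
    have below: "contraction ?S P \<subseteq> M" if "primeideal P ?L" for P
      using contraction_disjoint[OF S that[unfolded L]] by (auto simp: contraction_def)
    note prime = primeideal_contraction[OF S, folded L]
    note mono = contraction_strict_mono[OF S, folded L]
    show ?thesis
    \<comment> \<open>A strict inclusion of primes in the localization leads to a domain of
      dimension one; without any, the dimension is zero.\<close>
    proof (cases "\<exists>P Q. primeideal P ?L \<and> primeideal Q ?L \<and> P \<subset> Q")
      case True
      then obtain P Q where PQ: "primeideal P ?L" "primeideal Q ?L" "P \<subset> Q" by blast
      \<comment> \<open>The contraction of \<open>P\<close> is strictly below that of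
        \<open>Q\<close>, which is inside \<open>M\<close>; its elements are therefore annihilated
        from outside \<open>M\<close>.\<close>
      have lt: "contraction ?S P \<subset> M" using mono[OF PQ] below[OF PQ(2)] by blast
      have "domain ?L"
        unfolding L
      proof (rule domain_localizationI[OF S prime[OF PQ(1)]])
        show "contraction ?S P \<inter> ?S = {}" using lt by blast
        show "\<exists>s\<in>?S. s \<otimes>\<^bsub>R\<^esub> y = \<zero>\<^bsub>R\<^esub>" if "y \<in> contraction ?S P" for y
          using TAF_ring_nonmaximal_prime_annihilated[OF assms prime[OF PQ(1)] M lt that] by metis
      qed
      moreover have "krull_dim ?L \<le> 1"
      proof (rule L.krull_dim_le_1)
        fix P0 P1 P2
        assume "primeideal P0 ?L" "primeideal P1 ?L" "primeideal P2 ?L" "P0 \<subset> P1" "P1 \<subset> P2"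
        then show False
          using TAF_ring_no_prime_chain[OF assms prime prime prime mono mono] by blast
      qed
      moreover have "1 \<le> krull_dim ?L" by (rule L.krull_dim_ge_1[OF PQ])
      ultimately show ?thesis by (auto intro: antisym)
    next
      case False
      \<comment> \<open>The localization is nonzero because zero lies in \<open>M\<close>. It thus
        has a prime, and its dimension is zero rather than minus infinity.\<close>
      have "\<not> (\<exists>u\<in>?S. u \<otimes>\<^bsub>R\<^esub> \<one>\<^bsub>R\<^esub> = \<zero>\<^bsub>R\<^esub>)" using ideal_zero_mem[OF M.is_ideal] by auto
      then have "\<one>\<^bsub>?L\<^esub> \<noteq> \<zero>\<^bsub>?L\<^esub>"
        using fraction_eq_zero_iff[OF S one_closed S_one[OF S]] localization_one[OF S]
        unfolding L by simp
      then obtain P where "primeideal P ?L" using L.exists_primeideal by blast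
      then have "krull_dim ?L = 0" using False by (intro L.krull_dim_eq_0) auto
      then show ?thesis by blast
    qed
  qed
  then show ?thesis using le1 by blast
qed

end
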